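(* Let $e\ge 0$ be an integer. The cyclic additive group $\mathbb{Z}_{2^{e+2}}$ has a smooth skew morphism of skew-type $4$ if and only if $e\ge 4$, and in that case there are precisely $$S(e)=2^{e+2}-32$$ of them. Moreover (for $e\geq 4$), each such skew morphism is uniquely determined by a triple $(r,s,t)$ of integers with $0\le r<2^e$, $\nu_2(r)\le e-4$, and $t$ of multiplicative order $4$ modulo $2^{e-\nu_2(r)}$, via the formula $$\varphi(x)=x+\frac{4r\Big(\big(\sum_{i=1}^t s^{i-1}\big)^x-1\Big)}{\sum_{i=1}^t s^{i-1}-1}\pmod{2^{e+2}},$$ where (1) either $s=4r+2^{e-1}+1$ and $t=2^{e-\nu_2(r)-2}+1$ or $t=3\cdot 2^{e-\nu_2(r)-2}+1$, (2) or $s=2^{e-1}+1$ and $t=2^{e-\nu_2(r)-2}-1$ or $t=3\cdot 2^{e-\nu_2(r)-2}-1$.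
   Context: A skew morphism of a finite group $A$ (written additively when $A=\mathbb{Z}_n$) is a permutation $\varphi$ of $A$ fixing the identity element for which there is a function $\pi:A\to\mathbb{Z}_{m}$, where $m=|\varphi|$ is the order of $\varphi$ as a permutation, such that $\varphi(xy)=\varphi(x)\varphi^{\pi(x)}(y)$ for all $x,y\in A$; $\pi$ is called the power function of $\varphi$. The kernel of $\varphi$ is the subgroup $\operatorname{Ker}\varphi=\{x\in A\mid \pi(x)\equiv 1\pmod m\}$, and the skew-type of $\varphi$ is the index $[A:\operatorname{Ker}\varphi]$. The period of $\varphi$ is the smallest positive integer $\omega$ such that $\pi(\varphi^{\omega}(x))=\pi(x)$ in $\mathbb{Z}_m$ for all $x\in A$; $\varphi$ is called smooth if its period is $1$. For an integer $n$, $\nu_2(n)$ denotes the $2$-adic valuation of $n$ ($\nu_2(0)=\infty$, so $\nu_2(r)\le e-4$ forces $r\neq 0$). In the formula, $x$ is represented by a nonnegative integer and the fraction $\frac{S^x-1}{S-1}$ is the integer $1+S+\cdots+S^{x-1}$. *)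

theory Defs
  imports
    "HOL-Algebra.Algebra"
    "HOL-Number_Theory.Number_Theory"
begin

text \<open>
  Permutations of the underlying set are elements of \<^term>\<open>BijGroup (carrier G)\<close>, whose members are
  extensional functions; hence each permutation is counted exactly once.
\<close>

definition perm_order :: "('a, 'b) monoid_scheme \<Rightarrow> ('a \<Rightarrow> 'a) \<Rightarrow> nat" where
  "perm_order G \<phi> = group.ord (BijGroup (carrier G)) \<phi>"

text \<open>
  Elements of \<open>\<int>\<^sub>m\<close>, with \<open>m\<close> the order of the permutation, are represented by their canonical
  representatives in \<open>{..<m}\<close>. Together with extensionality this makes the power function of a
  skew morphism unique.
\<close>

definition is_power_function ::
    "('a, 'b) monoid_scheme \<Rightarrow> ('a \<Rightarrow> 'a) \<Rightarrow> ('a \<Rightarrow> nat) \<Rightarrow> bool" where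
  "is_power_function G \<phi> \<pi> \<longleftrightarrow>
     \<pi> \<in> carrier G \<rightarrow>\<^sub>E {..<perm_order G \<phi>} \<and>
     (\<forall>x\<in>carrier G. \<forall>y\<in>carrier G. \<phi> (x \<otimes>\<^bsub>G\<^esub> y) = \<phi> x \<otimes>\<^bsub>G\<^esub> (\<phi> ^^ \<pi> x) y)"

definition skew_morphism :: "('a, 'b) monoid_scheme \<Rightarrow> ('a \<Rightarrow> 'a) \<Rightarrow> bool" where
  "skew_morphism G \<phi> \<longleftrightarrow>
     group G \<and> finite (carrier G) \<and>
     \<phi> \<in> carrier (BijGroup (carrier G)) \<and> \<phi> \<one>\<^bsub>G\<^esub> = \<one>\<^bsub>G\<^esub> \<and>
     (\<exists>\<pi>. is_power_function G \<phi> \<pi>)"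

definition power_function :: "('a, 'b) monoid_scheme \<Rightarrow> ('a \<Rightarrow> 'a) \<Rightarrow> 'a \<Rightarrow> nat" where
  "power_function G \<phi> = (THE \<pi>. is_power_function G \<phi> \<pi>)"

text \<open>The congruence (rather than an equation) matters only for the identity, which has order \<open>1\<close>.\<close>

definition skew_kernel :: "('a, 'b) monoid_scheme \<Rightarrow> ('a \<Rightarrow> 'a) \<Rightarrow> 'a set" where
  "skew_kernel G \<phi> = {x \<in> carrier G. [power_function G \<phi> x = 1] (mod perm_order G \<phi>)}"

definition skew_type :: "('a, 'b) monoid_scheme \<Rightarrow> ('a \<Rightarrow> 'a) \<Rightarrow> nat" where
  "skew_type G \<phi> = card (rcosets\<^bsub>G\<^esub> (skew_kernel G \<phi>))"

definition skew_period :: "('a, 'b) monoid_scheme \<Rightarrow> ('a \<Rightarrow> 'a) \<Rightarrow> nat" where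
  "skew_period G \<phi> =
     (LEAST \<omega>. \<omega> > 0 \<and>
        (\<forall>x\<in>carrier G. power_function G \<phi> ((\<phi> ^^ \<omega>) x) = power_function G \<phi> x))"

definition smooth_skew_morphism :: "('a, 'b) monoid_scheme \<Rightarrow> ('a \<Rightarrow> 'a) \<Rightarrow> bool" where
  "smooth_skew_morphism G \<phi> \<longleftrightarrow> skew_morphism G \<phi> \<and> skew_period G \<phi> = 1"

definition smooth_skew_morphisms_of_type :: "('a, 'b) monoid_scheme \<Rightarrow> nat \<Rightarrow> ('a \<Rightarrow> 'a) set" where
  "smooth_skew_morphisms_of_type G k = {\<phi>. smooth_skew_morphism G \<phi> \<and> skew_type G \<phi> = k}"

text \<open>
  The parameters can be taken in \<^typ>\<open>nat\<close>: \<open>r \<ge> 0\<close> is required, and the formulas for \<open>s\<close> and \<open>t\<close> are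
  positive integers. All natural subtractions are exact when \<open>e \<ge> 4\<close>, since \<open>e - \<nu>\<^sub>2(r) \<ge> 4\<close>.
  The library has \<^term>\<open>multiplicity 2 (0::nat) = 0\<close> instead of \<open>\<infinity>\<close>, so \<open>r \<noteq> 0\<close> is stated separately.
\<close>

definition admissible_triples :: "nat \<Rightarrow> (nat \<times> nat \<times> nat) set" where
  "admissible_triples e = {(r, s, t).
     r < 2 ^ e \<and> r \<noteq> 0 \<and> multiplicity 2 r \<le> e - 4 \<and>
     ord (2 ^ (e - multiplicity 2 r)) t = 4 \<and>
     ((s = 4 * r + 2 ^ (e - 1) + 1 \<and>
       (t = 2 ^ (e - multiplicity 2 r - 2) + 1 \<or> t = 3 * 2 ^ (e - multiplicity 2 r - 2) + 1)) \<or>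
      (s = 2 ^ (e - 1) + 1 \<and>
       (t = 2 ^ (e - multiplicity 2 r - 2) - 1 \<or> t = 3 * 2 ^ (e - multiplicity 2 r - 2) - 1)))}"

text \<open>
  The quotient \<open>(S ^ x - 1) / (S - 1)\<close> is the integer \<open>1 + S + \<dots> + S ^ (x - 1)\<close>. Residue classes
  modulo \<open>2 ^ (e + 2)\<close> are represented by arbitrary natural numbers \<open>x\<close>.
\<close>

definition given_by_triple :: "nat \<Rightarrow> (int \<Rightarrow> int) \<Rightarrow> nat \<times> nat \<times> nat \<Rightarrow> bool" where
  "given_by_triple e \<phi> = (\<lambda>(r, s, t). \<forall>x::nat.
     \<phi> (int x mod 2 ^ (e + 2)) =
       int (x + 4 * r * (\<Sum>j<x. (\<Sum>i=1..t. s ^ (i - 1)) ^ j)) mod 2 ^ (e + 2))"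

end

theory Submission
  imports Defs
begin

text \<open>
  Write \<open>n = k M\<close>, where \<open>k > 1\<close> is the skew-type, and let \<open>\<phi>\<close> be a smooth skew morphism of \<open>\<int>\<^sub>n\<close> of order \<open>m\<close> with
  power function \<open>\<pi>\<close>. Smoothness makes \<open>\<pi>\<close> a homomorphism into the units modulo \<open>m\<close>; hence \<open>\<pi>(x) = t\<^sup>x\<close> with
  \<open>t = \<pi>(1)\<close>, the kernel is \<open>k \<int>\<close> with \<open>k\<close> the order of \<open>t\<close>, and \<open>\<phi>(x) \<equiv> x\<close> modulo \<open>k\<close>. Put
  \<open>\<phi>(1) = 1 + k r\<close> and \<open>\<phi>(k) = k s\<close>. Then \<open>\<phi>\<^sup>i(1) = 1 + k r (1 + s + \<dots> + s\<^sup>i\<^sup>-\<^sup>1)\<close>, and summing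
  \<open>\<phi>(x + 1) = \<phi>(x) + \<phi>\<^bsup>\<pi>(x)\<^esup>(1)\<close> gives
  \<open>\<phi>(x) = x + k r (1 + \<tau> + \<dots> + \<tau>\<^sup>x\<^sup>-\<^sup>1)\<close> with \<open>\<tau> = 1 + s + \<dots> + s\<^sup>t\<^sup>-\<^sup>1\<close>. The parameters satisfy
  \<open>s \<equiv> 1 + r (1 + \<tau> + \<dots> + \<tau>\<^sup>k\<^sup>-\<^sup>1)\<close> and \<open>s\<^sup>t \<equiv> s\<close> modulo \<open>M\<close>, and \<open>m\<close> divides \<open>i\<close> exactly if \<open>M\<close>
  divides \<open>r (1 + s + \<dots> + s\<^sup>i\<^sup>-\<^sup>1)\<close> (\<open>smooth_skew_morphism_params\<close>). Conversely, parameters with these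
  properties, where \<open>t\<close> has order \<open>k\<close> modulo \<open>m\<close>, define a smooth skew morphism of skew-type \<open>k\<close>
  (\<open>skew_map_smooth\<close>).

  For \<open>n = 2\<^sup>e\<^sup>+\<^sup>2\<close> and \<open>k = 4\<close>, the number \<open>s\<close> is odd if \<open>e > 0\<close>. If \<open>e \<le> 3\<close> then \<open>m\<close> divides \<open>8\<close>, and no unit
  modulo \<open>m\<close> has order \<open>4\<close>. If \<open>e \<ge> 4\<close>, parity arguments give \<open>s \<equiv> 1\<close> modulo \<open>4\<close>; then the geometric sum with
  \<open>i\<close> terms has the \<open>2\<close>-adic valuation of \<open>i\<close>, so that \<open>m = 2\<^bsup>e - v\<^esup>\<close> with \<open>v = \<nu>\<^sub>2(r)\<close>, and the existence of
  an element of order \<open>4\<close> forces \<open>v \<le> e - 4\<close>. There are four such classes \<open>t\<close>, and for each of them the two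
  congruences have a unique solution \<open>s \<equiv> 1\<close> (mod \<open>4\<close>) modulo \<open>2\<^sup>e\<close>, the one in the formula (\<open>solutions_1_mod_4\<close>,
  \<open>solutions_3_mod_4\<close>). The triples are thus counted by the \<open>2\<^sup>e - 8\<close> values of \<open>r\<close> times four, and
  distinct triples give distinct maps, as the values at \<open>1\<close> and \<open>2\<close> show (\<open>admissible_triple_unique\<close>).
\<close>

section \<open>Iterates and power functions\<close>

lemma carrier_BijGroup: "carrier (BijGroup S) = Bij S"
  by (simp add: BijGroup_def)

lemma BijGroup_mult: "f \<in> Bij S \<Longrightarrow> g \<in> Bij S \<Longrightarrow> f \<otimes>\<^bsub>BijGroup S\<^esub> g = compose S f g"
  by (simp add: BijGroup_def)

lemma BijGroup_pow_apply:
  assumes "\<phi> \<in> carrier (BijGroup S)" "x \<in> S"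
  shows "(\<phi> [^]\<^bsub>BijGroup S\<^esub> i) x = (\<phi> ^^ i) x"
  using assms(2)
proof (induction i arbitrary: x)
  case 0
  then show ?case by (simp add: BijGroup_def)
next
  case (Suc i)
  interpret group "BijGroup S" by (rule group_BijGroup)
  have "\<phi> [^]\<^bsub>BijGroup S\<^esub> i \<in> Bij S" "\<phi> \<in> Bij S"
    using assms(1) nat_pow_closed[OF assms(1), of i] by (simp_all only: carrier_BijGroup)
  moreover from this have "\<phi> x \<in> S"
    using Suc.prems by (auto dest: Bij_imp_funcset)
  ultimately have "(\<phi> [^]\<^bsub>BijGroup S\<^esub> Suc i) x = (\<phi> [^]\<^bsub>BijGroup S\<^esub> i) (\<phi> x)"
    using Suc.prems by (simp only: nat_pow_Suc BijGroup_mult compose_eq)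
  also have "\<dots> = (\<phi> ^^ i) (\<phi> x)"
    using \<open>\<phi> x \<in> S\<close> by (rule Suc.IH)
  finally show ?case
    by (simp add: funpow_swap1)
qed

lemma funpow_mem:
  assumes "\<phi> \<in> carrier (BijGroup S)" "x \<in> S"
  shows "(\<phi> ^^ i) x \<in> S"
  using assms by (induction i) (auto simp: BijGroup_def dest!: Bij_imp_funcset)

lemma perm_order_pos:
  assumes "finite (carrier G)" "\<phi> \<in> carrier (BijGroup (carrier G))"
  shows "perm_order G \<phi> > 0"
proof -
  interpret B: group "BijGroup (carrier G)" by (rule group_BijGroup)
  have "Bij (carrier G) \<subseteq> carrier G \<rightarrow>\<^sub>E carrier G"
    by (auto simp: Bij_def PiE_def dest: bij_betw_apply)
  then have "finite (carrier (BijGroup (carrier G)))"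
    using assms(1) by (auto simp: BijGroup_def intro: finite_subset finite_PiE)
  from B.ord_ge_1[OF this assms(2)] show ?thesis
    by (simp add: perm_order_def)
qed

lemma funpow_eq_iff_cong_perm_order:
  assumes fin: "finite (carrier G)" and \<phi>: "\<phi> \<in> carrier (BijGroup (carrier G))"
  shows "(\<forall>x\<in>carrier G. (\<phi> ^^ i) x = (\<phi> ^^ j) x) \<longleftrightarrow> [i = j] (mod perm_order G \<phi>)"
proof -
  let ?B = "BijGroup (carrier G)"
  interpret B: group ?B by (rule group_BijGroup)
  have ext: "\<phi> [^]\<^bsub>?B\<^esub> i \<in> extensional (carrier G)" for i :: nat
    using B.nat_pow_closed[OF \<phi>, of i] unfolding carrier_BijGroup by (rule Bij_imp_extensional)
  have "(\<forall>x\<in>carrier G. (\<phi> ^^ i) x = (\<phi> ^^ j) x) \<longleftrightarrow> \<phi> [^]\<^bsub>?B\<^esub> i = \<phi> [^]\<^bsub>?B\<^esub> j"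
    using BijGroup_pow_apply[OF \<phi>] extensionalityI[OF ext[of i] ext[of j]] by metis
  also have "\<dots> \<longleftrightarrow> [i = j] (mod perm_order G \<phi>)"
  proof (induction i j rule: linorder_wlog)
    case (le i j)
    have "\<phi> [^]\<^bsub>?B\<^esub> j = \<phi> [^]\<^bsub>?B\<^esub> i \<otimes>\<^bsub>?B\<^esub> \<phi> [^]\<^bsub>?B\<^esub> (j - i)"
      using le by (simp only: B.nat_pow_mult[OF \<phi>] le_add_diff_inverse)
    then have "\<phi> [^]\<^bsub>?B\<^esub> i = \<phi> [^]\<^bsub>?B\<^esub> j \<longleftrightarrow> \<phi> [^]\<^bsub>?B\<^esub> (j - i) = \<one>\<^bsub>?B\<^esub>"
      by (simp only: B.l_cancel_one'[OF B.nat_pow_closed[OF \<phi>] B.nat_pow_closed[OF \<phi>]])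
    also have "\<dots> \<longleftrightarrow> [i = j] (mod perm_order G \<phi>)"
      unfolding B.pow_eq_id[OF \<phi>] perm_order_def cong_sym_eq[of i j]
      using cong_altdef_nat[OF le] by blast
    finally show ?case .
  next
    case (sym i j)
    then show ?case by (metis cong_sym_eq)
  qed
  finally show ?thesis .
qed

lemma power_function_eqI:
  assumes "group G" and fin: "finite (carrier G)" and \<phi>: "\<phi> \<in> carrier (BijGroup (carrier G))"
    and p: "is_power_function G \<phi> p"
  shows "power_function G \<phi> = p"
  unfolding power_function_def
proof (rule the_equality)
  interpret group G by fact
  fix p' assume p': "is_power_function G \<phi> p'"
  have "p' x = p x" if x: "x \<in> carrier G" for x
  proof -
    have "(\<phi> ^^ p' x) y = (\<phi> ^^ p x) y" if y: "y \<in> carrier G" for y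
    proof -
      have "\<phi> x \<otimes>\<^bsub>G\<^esub> (\<phi> ^^ p' x) y = \<phi> x \<otimes>\<^bsub>G\<^esub> (\<phi> ^^ p x) y"
        using p p' x y unfolding is_power_function_def by metis
      then show ?thesis
        using funpow_mem[OF \<phi> x, of 1] funpow_mem[OF \<phi> y] by simp
    qed
    then have "[p' x = p x] (mod perm_order G \<phi>)"
      using funpow_eq_iff_cong_perm_order[OF fin \<phi>] by blast
    with p p' x show ?thesis
      unfolding is_power_function_def
      by (intro cong_less_modulus_unique_nat) (auto dest!: PiE_mem)
  qed
  then show "p' = p"
    using p p' unfolding is_power_function_def by (blast intro: PiE_ext)
qed fact

lemma skew_morphism_power_function:
  assumes "skew_morphism G \<phi>"
  shows "is_power_function G \<phi> (power_function G \<phi>)"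
  using assms power_function_eqI unfolding skew_morphism_def by metis

lemma skew_period_eq_1_iff:
  assumes "finite (carrier G)" and \<phi>: "\<phi> \<in> carrier (BijGroup (carrier G))"
  shows "skew_period G \<phi> = 1 \<longleftrightarrow>
    (\<forall>x\<in>carrier G. power_function G \<phi> (\<phi> x) = power_function G \<phi> x)"
proof -
  let ?P = "\<lambda>\<omega>. \<omega> > 0 \<and>
        (\<forall>x\<in>carrier G. power_function G \<phi> ((\<phi> ^^ \<omega>) x) = power_function G \<phi> x)"
  have "\<forall>x\<in>carrier G. (\<phi> ^^ perm_order G \<phi>) x = (\<phi> ^^ 0) x"
    by (subst funpow_eq_iff_cong_perm_order[OF assms]) (simp add: cong_def)
  then have "?P (perm_order G \<phi>)"
    using perm_order_pos[OF assms] by simp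
  then have *: "?P (skew_period G \<phi>)"
    unfolding skew_period_def by (rule LeastI)
  show ?thesis
  proof
    assume "skew_period G \<phi> = 1"
    with * show "\<forall>x\<in>carrier G. power_function G \<phi> (\<phi> x) = power_function G \<phi> x" by simp
  next
    assume "\<forall>x\<in>carrier G. power_function G \<phi> (\<phi> x) = power_function G \<phi> x"
    then have "skew_period G \<phi> \<le> 1"
      unfolding skew_period_def by (intro Least_le) simp
    with * show "skew_period G \<phi> = 1" by linarith
  qed
qed

section \<open>Geometric sums\<close>

text \<open>
  The geometric sum \<open>1 + s + \<dots> + s\<^sup>n\<^sup>-\<^sup>1\<close>, defined without division so that it makes sense modulo any integer.
\<close>

definition geo :: "'a::comm_semiring_1 \<Rightarrow> nat \<Rightarrow> 'a" where
  "geo s n = (\<Sum>j<n. s ^ j)"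

lemma geo_0 [simp]: "geo s 0 = 0"
  and geo_1 [simp]: "geo s (Suc 0) = 1"
  and geo_Suc: "geo s (Suc n) = geo s n + s ^ n"
  by (simp_all add: geo_def)

lemma geo_eq_sum_from_1: "geo s n = (\<Sum>i=1..n. s ^ (i - 1))"
  by (induction n) (simp_all add: geo_Suc)

lemma geo_add: "geo s (m + n) = geo s m + s ^ m * geo s n"
  by (induction n) (simp_all add: geo_Suc algebra_simps power_add)

lemma geo_Suc': "geo s (Suc n) = 1 + s * geo s n"
  using geo_add[of s 1 n] by simp

lemma geo_mult: "geo s (m * n) = geo s m * geo (s ^ m) n"
  by (induction n) (simp_all add: geo_Suc' geo_add algebra_simps)

lemma of_nat_geo: "of_nat (geo s n) = geo (of_nat s) n"
  by (simp add: geo_def)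

lemma geo_telescope: "(s - 1) * geo s n = s ^ n - 1" for s :: "'a::comm_ring_1"
  by (induction n) (simp_all add: geo_Suc algebra_simps)

lemma cong_geo: "[s = s'] (mod k) \<Longrightarrow> [geo s n = geo s' n] (mod k)" for s :: "'a::unique_euclidean_semiring"
  unfolding geo_def by (intro cong_sum cong_pow)

text \<open>
  The congruence \<open>s\<^sup>t \<equiv> s\<close> is the compatibility of the power function with the action on the kernel.
  Under it, exponents \<open>t\<^sup>x\<close> of the power function turn geometric sums into powers.
\<close>

lemma cong_power_power:
  fixes s M t :: nat
  assumes "[s ^ t = s] (mod M)"
  shows "[s ^ (t ^ x) = s] (mod M)"
proof (induction x)
  case (Suc x)
  have "[(s ^ (t ^ x)) ^ t = s ^ t] (mod M)"
    using Suc by (rule cong_pow)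
  also note assms
  finally show ?case by (simp add: power_mult[symmetric] mult.commute)
qed simp

lemma cong_geo_power:
  fixes s M t :: nat
  assumes "[s ^ t = s] (mod M)"
  shows "[geo s (t ^ x) = geo s t ^ x] (mod M)"
proof (induction x)
  case (Suc x)
  have "geo s (t ^ Suc x) = geo s (t ^ x) * geo (s ^ (t ^ x)) t"
    by (simp add: geo_mult[symmetric] mult.commute)
  also have "[\<dots> = geo s t ^ x * geo s t] (mod M)"
    using Suc cong_power_power[OF assms] by (intro cong_mult cong_geo)
  finally show ?case by (simp add: mult.commute)
qed simp

lemma cong_mult_modulus_iff:
  "k > 0 \<Longrightarrow> [k * a = k * b] (mod k * M) \<longleftrightarrow> [a = b] (mod M)" for k a b M :: nat
  unfolding cong_def mult_mod_right[symmetric] by simp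

section \<open>Residues\<close>

text \<open>
  Self-maps of \<open>\<int>\<^sub>n\<close> are handled through lifts \<open>h\<close> to the natural numbers: \<open>h\<close> lifts \<open>\<phi>\<close> if
  \<open>\<phi>\<close> sends the residue of \<open>y\<close> to the residue of \<open>h y\<close> for every natural number \<open>y\<close>.
\<close>

lemma funpow_lift_mod:
  fixes \<phi> :: "int \<Rightarrow> int" and h :: "nat \<Rightarrow> nat"
  assumes "\<And>y. \<phi> (int (y mod n)) = int (h y mod n)"
  shows "(\<phi> ^^ i) (int (y mod n)) = int ((h ^^ i) y mod n)"
  using assms by (induction i) simp_all

lemma carrier_integer_mod_group_cases:
  assumes "n > 0" "x \<in> carrier (integer_mod_group n)"
  obtains a where "a < n" "x = int a"
  using assms by (cases x) (auto simp: carrier_integer_mod_group)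

lemma int_mod_mem_carrier: "n > 0 \<Longrightarrow> int (y mod n) \<in> carrier (integer_mod_group n)"
  by (simp add: carrier_integer_mod_group)

lemma funpow_lift_cong_iff:
  assumes n: "n > 0" and \<phi>: "\<phi> \<in> carrier (BijGroup (carrier (integer_mod_group n)))"
    and h: "\<And>y. \<phi> (int (y mod n)) = int (h y mod n)"
  shows "(\<forall>y. [(h ^^ i) y = (h ^^ j) y] (mod n)) \<longleftrightarrow> [i = j] (mod perm_order (integer_mod_group n) \<phi>)"
proof -
  let ?G = "integer_mod_group n"
  have "(\<forall>y. [(h ^^ i) y = (h ^^ j) y] (mod n)) \<longleftrightarrow>
      (\<forall>y. (\<phi> ^^ i) (int (y mod n)) = (\<phi> ^^ j) (int (y mod n)))"
    by (simp add: funpow_lift_mod[of \<phi>, OF h] cong_def)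
  also have "\<dots> \<longleftrightarrow> (\<forall>x\<in>carrier ?G. (\<phi> ^^ i) x = (\<phi> ^^ j) x)"
    using n by (metis carrier_integer_mod_group_cases int_mod_mem_carrier mod_less)
  also have "\<dots> \<longleftrightarrow> [i = j] (mod perm_order ?G \<phi>)"
    using n by (intro funpow_eq_iff_cong_perm_order \<phi>) (simp add: carrier_integer_mod_group)
  finally show ?thesis .
qed

lemma card_rcosets_multiples:
  assumes "n > 0" "k dvd n"
  shows "card (rcosets\<^bsub>integer_mod_group n\<^esub> {x \<in> carrier (integer_mod_group n). int k dvd x}) = k"
proof -
  let ?G = "integer_mod_group n" and ?K = "{x \<in> carrier (integer_mod_group n). int k dvd x}"
  interpret group ?G by simp
  obtain M where M: "n = k * M" using assms by auto
  have k: "k > 0" "M > 0" using assms M by auto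
  have K: "?K = (\<lambda>j. int (k * j)) ` {..<M}"
  proof (intro equalityI subsetI)
    fix x assume "x \<in> ?K"
    then obtain j where j: "x = int k * j" and x: "0 \<le> x" "x < int k * int M"
      using assms(1) M by (auto simp: carrier_integer_mod_group)
    then have "0 \<le> j" "j < int M" using k by (auto simp: zero_le_mult_iff)
    then show "x \<in> (\<lambda>j. int (k * j)) ` {..<M}"
      using j by (intro image_eqI[of _ _ "nat j"]) auto
  qed (use assms k M in \<open>auto simp: carrier_integer_mod_group simp flip: of_nat_mult\<close>)
  have "card ?K = M"
    unfolding K using k by (subst card_image) (auto simp: inj_on_def)
  moreover have "subgroup ?K ?G"
  proof (rule subgroupI)
    fix x y assume "x \<in> ?K" "y \<in> ?K"
    then show "x \<otimes>\<^bsub>?G\<^esub> y \<in> ?K" "inv\<^bsub>?G\<^esub> x \<in> ?K"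
      using assms k M by (auto simp: carrier_integer_mod_group dvd_mod)
  qed (use assms in \<open>auto simp: carrier_integer_mod_group intro: exI[of _ 0]\<close>)
  moreover have "order ?G = n"
    using assms by (simp add: order_def carrier_integer_mod_group)
  ultimately have "card (rcosets\<^bsub>?G\<^esub> ?K) * M = k * M"
    using lagrange M by metis
  then show ?thesis using k by simp
qed

section \<open>From parameters to smooth skew morphisms\<close>

text \<open>
  The lift to \<open>\<nat>\<close> of the skew morphism of skew-type \<open>k\<close> with parameters \<open>r\<close>, \<open>s\<close>, \<open>t\<close>.
\<close>

definition param_map :: "nat \<Rightarrow> nat \<Rightarrow> nat \<Rightarrow> nat \<Rightarrow> nat \<Rightarrow> nat" where
  "param_map k r s t x = x + k * (r * geo (geo s t) x)"

lemma param_map_cong: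
  assumes "[s = s'] (mod M)"
  shows "[param_map k r s t x = param_map k r s' t x] (mod (k * M))"
  unfolding param_map_def using assms by (intro cong_add cong_refl cong_cmult_leftI cong_mult cong_geo)

text \<open>
  The conditions on the parameters for skew-type \<open>k\<close> on \<open>\<int>\<^sub>n\<close> with \<open>n = k M\<close>. Here \<open>m\<close> is the order of the
  permutation, \<open>\<phi>(1) = 1 + k r\<close>, \<open>\<phi>(k) = k s\<close>, and \<open>\<pi>(1) = t\<close>. The first congruence evaluates
  \<open>\<phi>(k)\<close> by the formula; the second compares the two ways to expand \<open>\<phi>(1 + k)\<close>; the condition on \<open>m\<close>
  says that \<open>\<phi>\<^sup>i\<close> fixes \<open>1\<close> exactly if \<open>m\<close> divides \<open>i\<close>.
\<close>

locale skew_params =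
  fixes k M m r s t :: nat
  assumes k: "k > 0" and M: "M > 0" and m: "m > 0"
    and s_eq: "[s = 1 + r * geo (geo s t) k] (mod M)"
    and s_pow_t: "[s ^ t = s] (mod M)"
    and dvd_iff: "\<And>i. M dvd r * geo s i \<longleftrightarrow> m dvd i"
    and ord_t: "ord m t = k"
begin

abbreviation "\<tau> \<equiv> geo s t"
abbreviation "n \<equiv> k * M"
abbreviation "F \<equiv> param_map k r s t"

text \<open>
  Writing \<open>s - 1\<close> for \<open>r (1 + \<tau> + \<dots> + \<tau>\<^sup>k\<^sup>-\<^sup>1)\<close>, this is the identity
  \<open>(s - 1) \<tau> = s\<^sup>t - 1 \<equiv> s - 1\<close>.
\<close>

lemma r_geo_tau: "[r * geo \<tau> k * \<tau> ^ i = r * geo \<tau> k] (mod M)"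
proof (induction i)
  case (Suc i)
  define D where "D = int (r * geo \<tau> k)"
  have *: "[int s - 1 = D] (mod int M)"
  proof -
    have "[int s = 1 + D] (mod int M)"
      using s_eq unfolding D_def by (simp flip: cong_int_iff)
    from cong_diff[OF this cong_refl[of 1]] show ?thesis by simp
  qed
  have "[D * int \<tau> = (int s - 1) * int \<tau>] (mod int M)"
    using * by (intro cong_mult) (auto simp: cong_sym)
  also have "(int s - 1) * int \<tau> = int (s ^ t) - 1"
    by (simp add: of_nat_geo geo_telescope)
  also have "[\<dots> = int s - 1] (mod int M)"
    using s_pow_t by (intro cong_diff) (simp_all add: cong_int_iff del: of_nat_power)
  also note *
  finally have "[r * geo \<tau> k * \<tau> = r * geo \<tau> k] (mod M)"
    unfolding D_def by (simp flip: cong_int_iff)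
  from cong_mult[OF this cong_refl[of "\<tau> ^ i"]] have "[r * geo \<tau> k * \<tau> ^ Suc i = r * geo \<tau> k * \<tau> ^ i] (mod M)"
    by (simp add: mult_ac)
  also note Suc
  finally show ?case .
qed simp

lemma r_geo_mult: "[r * geo \<tau> (k * j) = r * geo \<tau> k * j] (mod M)"
proof (induction j)
  case (Suc j)
  have "r * geo \<tau> (k * Suc j) = r * geo \<tau> (k * j) + r * geo \<tau> k * \<tau> ^ (k * j)"
    using geo_add[of \<tau> "k * j" k] by (simp add: algebra_simps)
  also have "[\<dots> = r * geo \<tau> k * j + r * geo \<tau> k] (mod M)"
    using Suc r_geo_tau by (rule cong_add)
  finally show ?case by (simp add: algebra_simps)
qed simp

text \<open>
  Translation by the kernel \<open>k \<int>\<close>, on which the map acts as multiplication by \<open>s\<close>. In particular the map is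
  well defined modulo \<open>n\<close>.
\<close>

lemma F_add_multiple: "[F (y + k * j) = F y + k * (j * s)] (mod n)"
proof -
  have "[r * geo \<tau> (k * j) * \<tau> ^ y = r * geo \<tau> k * j * \<tau> ^ y] (mod M)"
    using r_geo_mult by (rule cong_mult) simp
  also have "r * geo \<tau> k * j * \<tau> ^ y = r * geo \<tau> k * \<tau> ^ y * j" by simp
  also have "[\<dots> = r * geo \<tau> k * j] (mod M)"
    using r_geo_tau by (rule cong_mult) simp
  finally have "[j + r * geo \<tau> (k * j) * \<tau> ^ y = j + r * geo \<tau> k * j] (mod M)"
    by (rule cong_add[OF cong_refl])
  also have "j + r * geo \<tau> k * j = j * (1 + r * geo \<tau> k)" by (simp add: algebra_simps)
  also have "[\<dots> = j * s] (mod M)"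
    using s_eq by (intro cong_mult) (auto simp: cong_sym)
  finally have "[k * (j + r * geo \<tau> (k * j) * \<tau> ^ y) = k * (j * s)] (mod n)"
    by (rule cong_cmult_leftI)
  then have "[F y + k * (j + r * geo \<tau> (k * j) * \<tau> ^ y) = F y + k * (j * s)] (mod n)"
    by (rule cong_add[OF cong_refl])
  moreover have "F (y + k * j) = F y + k * (j + r * geo \<tau> (k * j) * \<tau> ^ y)"
    by (simp add: param_map_def geo_add algebra_simps)
  ultimately show ?thesis by simp
qed

lemma F_cong: "[x = y] (mod n) \<Longrightarrow> [F x = F y] (mod n)"
proof (induction x y rule: linorder_wlog)
  case (le x y)
  then obtain j where "y = x + k * (M * j)"
    by (metis cong_altdef_nat cong_sym_eq dvdE le_add_diff_inverse mult.assoc)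
  then have "[F y = F x + n * (j * s)] (mod n)"
    using F_add_multiple[of x "M * j"] by (simp add: mult_ac)
  also have "[F x + n * (j * s) = F x] (mod n)"
    by (simp add: cong_def)
  finally show ?case by (rule cong_sym)
qed (metis cong_sym_eq)

lemma F_funpow: "[(F ^^ i) y = y + k * (r * geo s i * geo \<tau> y)] (mod n)"
proof (induction i)
  case (Suc i)
  have "[(F ^^ Suc i) y = F (y + k * (r * geo s i * geo \<tau> y))] (mod n)"
    using F_cong[OF Suc] by simp
  also have "[F (y + k * (r * geo s i * geo \<tau> y)) = F y + k * (r * geo s i * geo \<tau> y * s)] (mod n)"
    by (rule F_add_multiple)
  also have "F y + k * (r * geo s i * geo \<tau> y * s) = y + k * (r * geo s (Suc i) * geo \<tau> y)"
    by (simp add: param_map_def geo_Suc' algebra_simps)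
  finally show ?case .
qed simp

lemma F_add: "[F (x + y) = F x + (F ^^ (t ^ x)) y] (mod n)"
proof -
  have "F (x + y) = F x + (y + k * (r * \<tau> ^ x * geo \<tau> y))"
    by (simp add: param_map_def geo_add algebra_simps)
  also have "[\<dots> = F x + (y + k * (r * geo s (t ^ x) * geo \<tau> y))] (mod n)"
    using cong_geo_power[OF s_pow_t, of x]
    by (intro cong_add cong_refl cong_cmult_leftI cong_mult) (auto simp: cong_sym)
  also have "[F x + (y + k * (r * geo s (t ^ x) * geo \<tau> y)) = F x + (F ^^ (t ^ x)) y] (mod n)"
    using F_funpow by (intro cong_add cong_refl) (auto simp: cong_sym)
  finally show ?thesis .
qed

lemma F_funpow_eq_self_iff: "(\<forall>y. [(F ^^ i) y = y] (mod n)) \<longleftrightarrow> m dvd i"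
proof
  assume "\<forall>y. [(F ^^ i) y = y] (mod n)"
  then have "[1 = 1 + k * (r * geo s i)] (mod n)"
    using F_funpow[of i 1] by (metis One_nat_def cong_sym cong_trans geo_1 mult.right_neutral)
  then have "n dvd k * (r * geo s i)"
    using cong_altdef_nat[of 1 "1 + k * (r * geo s i)" n] cong_sym_eq by (metis add_diff_cancel_left' le_add1)
  then show "m dvd i" using k dvd_iff by simp
next
  assume "m dvd i"
  then have "M dvd r * geo s i" using dvd_iff by simp
  then have "n dvd k * (r * geo s i * geo \<tau> y)" for y
    by (simp add: dvd_mult2)
  then have "[y + k * (r * geo s i * geo \<tau> y) = y] (mod n)" for y
    by (simp add: cong_add_lcancel_0_nat cong_0_iff)
  then show "\<forall>y. [(F ^^ i) y = y] (mod n)"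
    using F_funpow cong_trans by blast
qed

abbreviation "G \<equiv> integer_mod_group n"

text \<open>
  The permutation of \<open>\<int>\<^sub>n\<close> lifted by \<open>F\<close>, extensional as required of elements of \<^const>\<open>BijGroup\<close>.
\<close>

definition skew_map :: "int \<Rightarrow> int" where
  "skew_map = (\<lambda>x\<in>carrier G. int (F (nat x) mod n))"

lemma n_pos: "n > 0"
  using k M by simp

lemma skew_map_lift: "skew_map (int (y mod n)) = int (F y mod n)"
proof -
  have "[F (y mod n) = F y] (mod n)" by (rule F_cong) simp
  then show ?thesis
    using n_pos by (simp add: skew_map_def int_mod_mem_carrier cong_def)
qed

lemma coprime_m_t: "coprime m t"
  using ord_t k by (metis ord_eq_0 less_irrefl)

lemma skew_map_bij: "skew_map \<in> carrier (BijGroup (carrier G))"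
proof -
  have F_funpow_cong: "[(F ^^ i) x = (F ^^ i) y] (mod n)" if "[x = y] (mod n)" for i x y
    using that by (induction i) (auto intro: F_cong)
  have "inj_on skew_map (carrier G)"
  proof (rule inj_onI)
    fix x y assume "x \<in> carrier G" "y \<in> carrier G" and eq: "skew_map x = skew_map y"
    then obtain a b where ab: "a < n" "x = int a" "b < n" "y = int b"
      using n_pos by (metis carrier_integer_mod_group_cases)
    then have "[F a = F b] (mod n)"
      using eq skew_map_lift[of a] skew_map_lift[of b] by (simp add: cong_def)
    then have "[(F ^^ (m - 1)) (F a) = (F ^^ (m - 1)) (F b)] (mod n)"
      by (rule F_funpow_cong)
    then have "[(F ^^ m) a = (F ^^ m) b] (mod n)"
      using m by (metis Suc_diff_1 comp_apply funpow_Suc_right)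
    moreover have "[(F ^^ m) z = z] (mod n)" for z
      using F_funpow_eq_self_iff[of m] by simp
    ultimately have "[a = b] (mod n)"
      by (meson cong_sym cong_trans)
    then show "x = y" using ab cong_less_modulus_unique_nat by blast
  qed
  moreover have "skew_map ` carrier G \<subseteq> carrier G"
    using n_pos by (auto simp: skew_map_def int_mod_mem_carrier)
  moreover have "finite (carrier G)"
    using n_pos by (simp add: carrier_integer_mod_group)
  ultimately have "bij_betw skew_map (carrier G) (carrier G)"
    by (simp add: bij_betw_def endo_inj_surj)
  then show ?thesis
    by (simp add: carrier_BijGroup Bij_def skew_map_def)
qed

lemma perm_order_skew_map: "perm_order G skew_map = m"
proof (rule dvd_antisym)
  have "[i = 0] (mod perm_order G skew_map) \<longleftrightarrow> m dvd i" for i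
    using funpow_lift_cong_iff[OF n_pos skew_map_bij skew_map_lift, of i 0] F_funpow_eq_self_iff[of i]
    by simp
  then have *: "perm_order G skew_map dvd i \<longleftrightarrow> m dvd i" for i
    by (simp add: cong_0_iff)
  show "perm_order G skew_map dvd m" "m dvd perm_order G skew_map"
    using *[of m] *[of "perm_order G skew_map"] by auto
qed

lemma is_power_function_skew_map:
  "is_power_function G skew_map (\<lambda>x\<in>carrier G. t ^ nat x mod m)"
  unfolding is_power_function_def perm_order_skew_map
proof (intro conjI ballI)
  show "(\<lambda>x\<in>carrier G. t ^ nat x mod m) \<in> carrier G \<rightarrow>\<^sub>E {..<m}"
    using m by auto
  fix x y assume x: "x \<in> carrier G" and y: "y \<in> carrier G"
  then obtain a b where ab: "a < n" "x = int a" "b < n" "y = int b"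
    using n_pos by (metis carrier_integer_mod_group_cases)
  have "[(F ^^ (t ^ a mod m)) b = (F ^^ (t ^ a)) b] (mod n)"
    using funpow_lift_cong_iff[OF n_pos skew_map_bij skew_map_lift, of "t ^ a mod m" "t ^ a"]
    by (simp add: perm_order_skew_map)
  then have "[F (a + b) = F a + (F ^^ (t ^ a mod m)) b] (mod n)"
    by (meson F_add cong_add cong_refl cong_sym cong_trans)
  then have "int (F (a + b) mod n) = (int (F a mod n) + int ((F ^^ (t ^ a mod m)) b mod n)) mod int n"
    by (simp only: cong_def mod_add_eq of_nat_add[symmetric] of_nat_mod[symmetric])
  moreover have "x \<otimes>\<^bsub>G\<^esub> y = int ((a + b) mod n)"
    using ab by (simp only: mult_integer_mod_group of_nat_add of_nat_mod)
  ultimately show "skew_map (x \<otimes>\<^bsub>G\<^esub> y) =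
      skew_map x \<otimes>\<^bsub>G\<^esub> (skew_map ^^ (\<lambda>x\<in>carrier G. t ^ nat x mod m) x) y"
    using x ab skew_map_lift[of a] skew_map_lift[of "a + b"]
      funpow_lift_mod[of skew_map, OF skew_map_lift, of "t ^ a mod m" b]
    by (simp only: mult_integer_mod_group restrict_apply if_True nat_int mod_less)
qed

lemma power_function_skew_map: "x \<in> carrier G \<Longrightarrow> power_function G skew_map x = t ^ nat x mod m"
  using power_function_eqI[OF _ _ skew_map_bij is_power_function_skew_map] n_pos
  by (simp add: carrier_integer_mod_group)

lemma skew_map_smooth: "skew_map \<in> smooth_skew_morphisms_of_type G k"
proof -
  have fin: "finite (carrier G)" using n_pos by (simp add: carrier_integer_mod_group)
  have "skew_map 0 = 0"
    using skew_map_lift[of 0] by (simp add: param_map_def)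
  then have "skew_morphism G skew_map"
    using fin skew_map_bij is_power_function_skew_map by (auto simp: skew_morphism_def)
  moreover have "skew_period G skew_map = 1"
    unfolding skew_period_eq_1_iff[OF fin skew_map_bij]
  proof
    fix x assume x: "x \<in> carrier G"
    then obtain a where a: "a < n" "x = int a"
      using n_pos by (metis carrier_integer_mod_group_cases)
    have "[F a mod n = a] (mod k)"
      by (simp add: cong_def param_map_def mod_mod_cancel)
    then have "[t ^ (F a mod n) = t ^ a] (mod m)"
      using coprime_m_t ord_t by (simp add: order_divides_expdiff)
    moreover have "skew_map x = int (F a mod n)"
      using a skew_map_lift[of a] by simp
    ultimately show "power_function G skew_map (skew_map x) = power_function G skew_map x"
      using a n_pos int_mod_mem_carrier[of n "F a"] x
      by (simp add: power_function_skew_map cong_def del: of_nat_mod)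
  qed
  moreover have "skew_kernel G skew_map = {x \<in> carrier G. int k dvd x}"
  proof -
    have "[power_function G skew_map x = 1] (mod m) \<longleftrightarrow> int k dvd x" if "x \<in> carrier G" for x
    proof -
      obtain a where a: "a < n" "x = int a"
        using n_pos \<open>x \<in> carrier G\<close> by (metis carrier_integer_mod_group_cases)
      have "[power_function G skew_map x = 1] (mod m) \<longleftrightarrow> [t ^ a = 1] (mod m)"
        using that a by (simp add: power_function_skew_map)
      then show ?thesis
        using ord_divides[of t a m] ord_t a by simp
    qed
    then show ?thesis
      unfolding skew_kernel_def perm_order_skew_map by blast
  qed
  then have "skew_type G skew_map = k"
    unfolding skew_type_def using n_pos card_rcosets_multiples[of n k] by simp
  ultimately show ?thesis
    by (simp add: smooth_skew_morphisms_of_type_def smooth_skew_morphism_def)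
qed

end

section \<open>From smooth skew morphisms to parameters\<close>

text \<open>
  The converse analysis: \<open>\<phi>\<close> is any smooth skew morphism of \<open>\<int>\<^sub>n\<close> of skew-type \<open>k > 1\<close>.
\<close>

locale smooth_cyclic =
  fixes n k :: nat and \<phi> :: "int \<Rightarrow> int"
  assumes n_pos: "n > 0" and k_gt_1: "k > 1"
    and smooth: "\<phi> \<in> smooth_skew_morphisms_of_type (integer_mod_group n) k"
begin

abbreviation "G \<equiv> integer_mod_group n"

text \<open>
  The lift of \<open>\<phi>\<close> with values in \<open>{..<n}\<close>, the power function as a function of natural numbers,
  the order of \<open>\<phi>\<close>, and the value of the power function at the generator.
\<close>

definition h :: "nat \<Rightarrow> nat" where "h y = nat (\<phi> (int (y mod n)))"

definition p :: "nat \<Rightarrow> nat" where "p y = power_function G \<phi> (int (y mod n))"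

definition m :: nat where "m = perm_order G \<phi>"

definition t :: nat where "t = p 1"

lemma skew: "skew_morphism G \<phi>" and period: "skew_period G \<phi> = 1" and type_k: "skew_type G \<phi> = k"
  using smooth by (auto simp: smooth_skew_morphisms_of_type_def smooth_skew_morphism_def)

lemma fin: "finite (carrier G)"
  using skew by (simp add: skew_morphism_def)

lemma bij: "\<phi> \<in> carrier (BijGroup (carrier G))"
  using skew by (simp add: skew_morphism_def)

lemma m_pos: "m > 0"
  unfolding m_def by (rule perm_order_pos[OF fin bij])

lemma \<phi>_lift: "\<phi> (int (y mod n)) = int (h y mod n)"
proof -
  have "\<phi> (int (y mod n)) \<in> carrier G"
    using funpow_mem[OF bij int_mod_mem_carrier[OF n_pos], of 1] by simp
  then obtain a where "a < n" "\<phi> (int (y mod n)) = int a"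
    using n_pos by (metis carrier_integer_mod_group_cases)
  then show ?thesis by (simp add: h_def)
qed

lemma h_less: "h y < n"
proof -
  have "h y = h y mod n"
    using \<phi>_lift[of y] by (metis h_def nat_int)
  also have "\<dots> < n" using n_pos by simp
  finally show ?thesis .
qed

lemma h_cong: "[x = y] (mod n) \<Longrightarrow> h x = h y"
  by (simp add: h_def cong_def)

lemma h_funpow_iff: "(\<forall>y. [(h ^^ i) y = (h ^^ j) y] (mod n)) \<longleftrightarrow> [i = j] (mod m)"
  unfolding m_def by (rule funpow_lift_cong_iff[OF n_pos bij \<phi>_lift])

lemma h_funpow_exp_cong: "[i = j] (mod m) \<Longrightarrow> [(h ^^ i) y = (h ^^ j) y] (mod n)"
  using h_funpow_iff by blast

lemma h_add: "[h (x + y) = h x + (h ^^ p x) y] (mod n)"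
proof -
  have "int (x mod n) \<otimes>\<^bsub>G\<^esub> int (y mod n) = int ((x + y) mod n)"
    by (simp only: mult_integer_mod_group of_nat_add[symmetric] of_nat_mod[symmetric] mod_add_eq)
  moreover have "\<phi> (int (x mod n) \<otimes>\<^bsub>G\<^esub> int (y mod n)) =
      \<phi> (int (x mod n)) \<otimes>\<^bsub>G\<^esub> (\<phi> ^^ p x) (int (y mod n))"
    using skew_morphism_power_function[OF skew] int_mod_mem_carrier[OF n_pos]
    unfolding is_power_function_def p_def by blast
  ultimately have "int (h (x + y) mod n) = (int (h x mod n) + int ((h ^^ p x) y mod n)) mod int n"
    by (simp only: \<phi>_lift funpow_lift_mod[of \<phi>, OF \<phi>_lift] mult_integer_mod_group)
  then have "int (h (x + y) mod n) = int ((h x + (h ^^ p x) y) mod n)"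
    by (simp only: of_nat_add[symmetric] of_nat_mod[symmetric] mod_add_eq)
  then show ?thesis by (simp only: cong_def of_nat_eq_iff)
qed

lemma h_0: "h 0 = 0"
  using skew by (simp add: h_def skew_morphism_def)

lemma p_cong: "[x = y] (mod n) \<Longrightarrow> p x = p y"
  by (simp add: p_def cong_def)

lemma p_less: "p x < m"
  using skew_morphism_power_function[OF skew] int_mod_mem_carrier[OF n_pos, of x]
  unfolding is_power_function_def p_def m_def by blast

lemma p_h: "p (h y) = p y"
proof -
  have "p (h y) = power_function G \<phi> (\<phi> (int (y mod n)))"
    unfolding p_def \<phi>_lift ..
  also have "\<dots> = p y"
    using period int_mod_mem_carrier[OF n_pos] unfolding skew_period_eq_1_iff[OF fin bij] p_def by blast
  finally show ?thesis .
qed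

lemma p_h_funpow: "p ((h ^^ i) y) = p y"
  by (induction i) (simp_all add: p_h)

text \<open>
  Smoothness makes the exponent \<open>i \<pi>(x)\<close>; in general it would be \<open>\<Sum>j<i. \<pi>(\<phi>\<^sup>j(x))\<close>.
\<close>

lemma h_funpow_add: "[(h ^^ i) (x + y) = (h ^^ i) x + (h ^^ (i * p x)) y] (mod n)"
proof (induction i)
  case (Suc i)
  have "(h ^^ Suc i) (x + y) = h ((h ^^ i) x + (h ^^ (i * p x)) y)"
    using h_cong[OF Suc] by simp
  also have "[\<dots> = h ((h ^^ i) x) + (h ^^ p ((h ^^ i) x)) ((h ^^ (i * p x)) y)] (mod n)"
    by (rule h_add)
  finally show ?case
    by (simp add: p_h_funpow funpow_add)
qed simp

text \<open>
  The power function of a smooth skew morphism is a homomorphism into the units modulo \<open>m\<close>, hence \<open>\<pi>(x) = t\<^sup>x\<close>.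
\<close>

lemma p_add: "[p (x + y) = p x * p y] (mod m)"
proof -
  have "[(h ^^ p (x + y)) z = (h ^^ (p x * p y)) z] (mod n)" for z
  proof -
    have "[h (x + y) + (h ^^ p (x + y)) z = h (x + y + z)] (mod n)"
      by (intro cong_sym[OF h_add])
    also have "[h (x + y + z) = h x + (h ^^ p x) (y + z)] (mod n)"
      using h_add[of x "y + z"] by (simp add: add.assoc)
    also have "[h x + (h ^^ p x) (y + z) = h x + ((h ^^ p x) y + (h ^^ (p x * p y)) z)] (mod n)"
      by (intro cong_add cong_refl h_funpow_add)
    also have "h x + ((h ^^ p x) y + (h ^^ (p x * p y)) z) = h x + (h ^^ p x) y + (h ^^ (p x * p y)) z"
      by simp
    also have "[h x + (h ^^ p x) y + (h ^^ (p x * p y)) z = h (x + y) + (h ^^ (p x * p y)) z] (mod n)"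
      by (intro cong_add cong_refl cong_sym[OF h_add])
    finally show ?thesis by (simp add: cong_add_lcancel_nat)
  qed
  then show ?thesis using h_funpow_iff by blast
qed

lemma p_0: "[p 0 = 1] (mod m)"
proof -
  have "[(h ^^ p 0) z = (h ^^ 1) z] (mod n)" for z
    using h_add[of 0 z] by (simp add: h_0 cong_sym)
  then show ?thesis using h_funpow_iff by blast
qed

lemma p_eq_power: "[p x = t ^ x] (mod m)"
proof (induction x)
  case 0
  then show ?case using p_0 by simp
next
  case (Suc x)
  have "[p (Suc x) = p 1 * p x] (mod m)"
    using p_add[of 1 x] by simp
  also have "[p 1 * p x = t * t ^ x] (mod m)"
    unfolding t_def using Suc by (intro cong_mult cong_refl) (simp add: t_def)
  finally show ?case by simp
qed

lemma coprime_m_t: "coprime m t" and ord_dvd_n: "ord m t dvd n"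
proof -
  have "[t ^ n = p n] (mod m)"
    by (rule cong_sym[OF p_eq_power])
  also have "p n = p 0"
    by (rule p_cong) (simp add: cong_def)
  also note p_0
  finally show "ord m t dvd n" by (simp only: ord_divides)
  then show "coprime m t"
    using n_pos by (metis dvd_0_left_iff less_irrefl ord_eq_0)
qed

text \<open>
  The kernel consists of the multiples of the order of \<open>t\<close>, so that order is the index \<open>k\<close>.
\<close>

lemma ord_t: "ord m t = k"
proof -
  have "[power_function G \<phi> x = 1] (mod m) \<longleftrightarrow> int (ord m t) dvd x" if "x \<in> carrier G" for x
  proof -
    obtain a where a: "a < n" "x = int a"
      using n_pos \<open>x \<in> carrier G\<close> by (metis carrier_integer_mod_group_cases)
    then have "[power_function G \<phi> x = 1] (mod m) \<longleftrightarrow> [p a = 1] (mod m)"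
      by (simp add: p_def)
    also have "\<dots> \<longleftrightarrow> [t ^ a = 1] (mod m)"
      using p_eq_power[of a] by (simp add: cong_def)
    finally show ?thesis
      using a by (simp only: ord_divides of_nat_dvd_iff)
  qed
  then have "skew_kernel G \<phi> = {x \<in> carrier G. int (ord m t) dvd x}"
    unfolding skew_kernel_def m_def by blast
  then show ?thesis
    using type_k card_rcosets_multiples[OF n_pos ord_dvd_n] by (simp add: skew_type_def)
qed

text \<open>
  The kernel has \<open>M\<close> elements. The parameters \<open>r\<close> and \<open>s\<close> are read off from the values at \<open>1\<close> and \<open>k\<close>;
  since \<open>\<phi>(x) \<equiv> x\<close> modulo \<open>k\<close>, the two divisions leave the remainders \<open>1\<close> and \<open>0\<close>.
\<close>

definition M :: nat where "M = n div k"
definition r :: nat where "r = h 1 div k"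
definition s :: nat where "s = h k div k"

lemma n_eq: "k * M = n"
  using ord_dvd_n ord_t by (simp add: M_def)

lemma M_pos: "M > 0"
  using n_pos n_eq by (metis gr0I mult_0_right)

text \<open>
  This is smoothness: \<open>x\<close> and \<open>\<phi>(x)\<close> have the same value of \<open>\<pi>\<close>, hence lie in the same coset of the kernel.
\<close>

lemma h_cong_self: "[h x = x] (mod k)"
proof -
  have "[t ^ h x = t ^ x] (mod m)"
    using p_eq_power[of "h x"] p_eq_power[of x] by (simp add: p_h cong_def)
  then show ?thesis
    using coprime_m_t ord_t by (simp add: order_divides_expdiff)
qed

lemma h_1: "h 1 = 1 + k * r"
proof -
  have "h 1 mod k = 1"
    using h_cong_self[of 1] k_gt_1 by (simp add: cong_def)
  then show ?thesis
    unfolding r_def by (metis add.commute mult_div_mod_eq)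
qed

lemma r_less: "r < M"
proof -
  have "k * r < k * M"
    using h_less[of 1] h_1 n_eq by linarith
  then show ?thesis by simp
qed

lemma h_k: "h k = k * s"
proof -
  have "k dvd h k"
    using h_cong_self[of k] by (simp add: cong_def mod_eq_0_iff_dvd)
  then show ?thesis by (simp add: s_def)
qed

lemma p_multiple: "[p (k * j) = 1] (mod m)"
proof -
  have "[t ^ (k * j) = 1] (mod m)"
    unfolding ord_divides ord_t by simp
  with p_eq_power show ?thesis
    by (rule cong_trans)
qed

lemma h_multiple_add: "[h (k * j + y) = h (k * j) + h y] (mod n)"
proof -
  have "[(h ^^ p (k * j)) y = (h ^^ 1) y] (mod n)"
    by (rule h_funpow_exp_cong[OF p_multiple])
  then have "[(h ^^ p (k * j)) y = h y] (mod n)" by simp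
  then have "[h (k * j) + (h ^^ p (k * j)) y = h (k * j) + h y] (mod n)"
    by (intro cong_add cong_refl)
  with h_add show ?thesis by (rule cong_trans)
qed

lemma h_multiple: "[h (k * j) = k * (j * s)] (mod n)"
proof (induction j)
  case (Suc j)
  have "[h (k * Suc j) = h (k * 1) + h (k * j)] (mod n)"
    using h_multiple_add[of 1 "k * j"] by simp
  also have "[h (k * 1) + h (k * j) = k * s + k * (j * s)] (mod n)"
    using Suc by (intro cong_add) (simp_all add: h_k)
  finally show ?case by (simp add: algebra_simps)
qed (simp add: h_0)

lemma h_add_multiple: "[h (y + k * j) = h y + k * (j * s)] (mod n)"
proof -
  have "[h (y + k * j) = h (k * j) + h y] (mod n)"
    using h_multiple_add[of j y] by (simp add: add.commute)
  also have "[h (k * j) + h y = k * (j * s) + h y] (mod n)"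
    using h_multiple by (intro cong_add cong_refl)
  finally show ?thesis by (simp add: add.commute)
qed

lemma h_funpow_multiple: "[(h ^^ i) (k * j) = k * (j * s ^ i)] (mod n)"
proof (induction i)
  case (Suc i)
  have "(h ^^ Suc i) (k * j) = h (k * (j * s ^ i))"
    using h_cong[OF Suc] by simp
  also have "[\<dots> = k * (j * s ^ i * s)] (mod n)"
    by (rule h_multiple)
  finally show ?case by (simp add: mult_ac)
qed simp

lemma h_funpow_1: "[(h ^^ i) 1 = 1 + k * (r * geo s i)] (mod n)"
proof (induction i)
  case (Suc i)
  have "(h ^^ Suc i) 1 = h (1 + k * (r * geo s i))"
    using h_cong[OF Suc] by simp
  also have "[\<dots> = h 1 + k * (r * geo s i * s)] (mod n)"
    by (rule h_add_multiple)
  also have "h 1 + k * (r * geo s i * s) = 1 + k * (r * geo s (Suc i))"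
    unfolding h_1 geo_Suc' by (simp add: algebra_simps)
  finally show ?case .
qed simp

lemma cong_k_cancel: "[k * a = k * b] (mod n) \<longleftrightarrow> [a = b] (mod M)"
  using cong_mult_modulus_iff[of k a b M] k_gt_1 unfolding n_eq by simp

lemma s_pow_t: "[s ^ t = s] (mod M)"
proof -
  have "[h 1 + (h ^^ p 1) (k * 1) = h (1 + k * 1)] (mod n)"
    by (rule cong_sym[OF h_add])
  also have "[h (1 + k * 1) = h 1 + k * (1 * s)] (mod n)"
    by (rule h_add_multiple)
  finally have "[(h ^^ p 1) (k * 1) = k * s] (mod n)"
    by (simp add: cong_add_lcancel_nat)
  with h_funpow_multiple[of t 1] have "[k * s ^ t = k * s] (mod n)"
    unfolding t_def by (simp add: cong_def)
  then show ?thesis by (simp add: cong_k_cancel)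
qed

lemma s_pow_m: "[s ^ m = 1] (mod M)"
proof -
  have "[(h ^^ m) (k * 1) = (h ^^ 0) (k * 1)] (mod n)"
    by (rule h_funpow_exp_cong) (simp add: cong_def)
  with h_funpow_multiple[of m 1] have "[k * s ^ m = k * 1] (mod n)"
    by (simp add: cong_def)
  then show ?thesis by (simp only: cong_k_cancel)
qed

text \<open>
  A power of \<open>\<phi>\<close> that fixes the generator \<open>1\<close> is trivial. For the induction one needs that
  \<open>\<phi>\<^sup>i\<close> fixing \<open>1\<close> implies that \<open>\<phi>\<close> to the power \<open>i \<pi>(x)\<close> does.
\<close>

lemma m_dvd_iff: "M dvd r * geo s i \<longleftrightarrow> m dvd i"
proof -
  have one: "[(h ^^ j) 1 = 1] (mod n) \<longleftrightarrow> M dvd r * geo s j" for j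
  proof -
    have "[(h ^^ j) 1 = 1] (mod n) \<longleftrightarrow> [1 + k * (r * geo s j) = 1] (mod n)"
      unfolding cong_def h_funpow_1[of j, unfolded cong_def] by (rule refl)
    then show ?thesis
      using cong_k_cancel[of "r * geo s j" 0]
      unfolding cong_add_lcancel_0_nat by (simp add: cong_0_iff)
  qed
  show ?thesis
  proof
    assume i: "M dvd r * geo s i"
    have "[(h ^^ i) x = (h ^^ 0) x] (mod n)" for x
    proof (induction x)
      case 0
      have "(h ^^ i) 0 = 0" by (induction i) (simp_all add: h_0)
      then show ?case by simp
    next
      case (Suc x)
      have "M dvd r * geo s (i * p x)"
        using i by (simp add: geo_mult dvd_mult2 flip: mult.assoc)
      then have *: "[(h ^^ (i * p x)) 1 = 1] (mod n)" using one by blast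
      have "[(h ^^ i) (x + 1) = (h ^^ i) x + (h ^^ (i * p x)) 1] (mod n)"
        by (rule h_funpow_add)
      also have "[(h ^^ i) x + (h ^^ (i * p x)) 1 = (h ^^ 0) x + 1] (mod n)"
        using Suc * by (rule cong_add)
      finally show ?case by simp
    qed
    then have "[i = 0] (mod m)" using h_funpow_iff by blast
    then show "m dvd i" by (simp add: cong_0_iff)
  next
    assume "m dvd i"
    then have "[i = 0] (mod m)" by (simp add: cong_0_iff)
    from h_funpow_exp_cong[OF this, of 1] show "M dvd r * geo s i"
      using one by simp
  qed
qed

lemma h_eq_param_map: "[h x = param_map k r s t x] (mod n)"
proof (induction x)
  case (Suc x)
  have "[h (x + 1) = h x + (h ^^ p x) 1] (mod n)"
    by (rule h_add)
  also have "[h x + (h ^^ p x) 1 = param_map k r s t x + (h ^^ (t ^ x)) 1] (mod n)"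
    by (intro cong_add Suc h_funpow_exp_cong p_eq_power)
  also have "[param_map k r s t x + (h ^^ (t ^ x)) 1 =
      param_map k r s t x + (1 + k * (r * geo s (t ^ x)))] (mod n)"
    by (intro cong_add cong_refl h_funpow_1)
  also have "[param_map k r s t x + (1 + k * (r * geo s (t ^ x))) =
      param_map k r s t x + (1 + k * (r * geo s t ^ x))] (mod n)"
    by (intro cong_add cong_refl, subst cong_k_cancel) (intro cong_mult cong_refl cong_geo_power s_pow_t)
  finally show ?case
    by (simp add: param_map_def geo_Suc algebra_simps)
qed (simp add: h_0 param_map_def)

lemma skew_params: "skew_params k M m r s t"
proof
  have "[k * s = k + k * (r * geo (geo s t) k)] (mod n)"
    using h_eq_param_map[of k] by (simp add: h_k param_map_def)
  then have "[k * s = k * (1 + r * geo (geo s t) k)] (mod n)"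
    by (simp add: algebra_simps)
  then show "[s = 1 + r * geo (geo s t) k] (mod M)"
    by (simp only: cong_k_cancel)
qed (use k_gt_1 M_pos m_pos s_pow_t m_dvd_iff ord_t in auto)

lemma \<phi>_eq_param_map: "\<phi> (int (y mod n)) = int (param_map k r s t y mod n)"
  using h_eq_param_map[of y] unfolding \<phi>_lift cong_def by simp

lemma t_less: "t < m"
  unfolding t_def by (rule p_less)

end

lemma smooth_skew_morphism_params:
  assumes "n > 0" "k > 1" "\<phi> \<in> smooth_skew_morphisms_of_type (integer_mod_group n) k"
  obtains M m r s t where "k * M = n" "r < M" "t < m" "skew_params k M m r s t" "[s ^ m = 1] (mod M)"
    "\<And>y. \<phi> (int (y mod n)) = int (param_map k r s t y mod n)"
proof -
  interpret smooth_cyclic n k \<phi>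
    using assms by unfold_locales
  show ?thesis
    by (rule that[OF n_eq r_less t_less skew_params s_pow_m \<phi>_eq_param_map])
qed

section \<open>Two-adic valuations of geometric sums\<close>

lemma pow2_dvd_odd_mult: "odd c \<Longrightarrow> 2 ^ k dvd c * x \<longleftrightarrow> 2 ^ k dvd x" for c x :: int
  by (metis coprime_dvd_mult_right_iff coprime_left_2_iff_odd coprime_power_left_iff)

lemma pow2_dvd_exact:
  fixes x :: int
  assumes "2 ^ k dvd x" "\<not> 2 ^ Suc k dvd x"
  obtains d where "odd d" "x = 2 ^ k * d"
proof -
  from assms(1) obtain d where d: "x = 2 ^ k * d" by auto
  with assms(2) have "odd d" by (auto simp: mult.commute)
  with d show ?thesis by (rule that[rotated])
qed

text \<open>
  For \<open>s \<equiv> 1\<close> modulo \<open>4\<close>, the geometric sum with \<open>n\<close> terms has the same \<open>2\<close>-adic valuation as \<open>n\<close>.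
\<close>

lemma pow2_dvd_geo_iff:
  fixes s :: int
  assumes "[s = 1] (mod 4)"
  shows "2 ^ k dvd geo s n \<longleftrightarrow> 2 ^ k dvd n"
  using assms
proof (induction k arbitrary: s n)
  case (Suc k)
  obtain a where a: "s = 1 + 4 * a"
    using Suc.prems by (metis cong_iff_lin cong_sym)
  show ?case
  proof (cases "even n")
    case True
    then obtain n' where n: "n = 2 * n'" by auto
    have "geo s n = 2 * ((1 + 2 * a) * geo (s\<^sup>2) n')"
      unfolding n geo_mult by (simp add: geo_def lessThan_Suc numeral_2_eq_2 a algebra_simps)
    then have "2 ^ Suc k dvd geo s n \<longleftrightarrow> 2 ^ k dvd (1 + 2 * a) * geo (s\<^sup>2) n'"
      by simp
    also have "\<dots> \<longleftrightarrow> 2 ^ k dvd geo (s\<^sup>2) n'"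
      by (rule pow2_dvd_odd_mult) simp
    also have "\<dots> \<longleftrightarrow> 2 ^ k dvd n'"
      using cong_pow[OF Suc.prems, of 2] by (intro Suc.IH) simp
    finally show ?thesis by (simp add: n)
  next
    case False
    have "[geo s n = geo 1 n] (mod 2)"
      by (rule cong_geo) (unfold a cong_def, presburger)
    then have "odd (geo s n)"
      using False by (simp add: geo_def cong_def) presburger
    then show ?thesis using False by auto
  qed
qed simp

lemma odd_if_cong_1_mod_4: "[s = 1] (mod 4) \<Longrightarrow> odd s" for s :: int
  unfolding cong_def by presburger

lemma geo_cong_iff:
  fixes s :: int
  assumes "[s = 1] (mod 4)"
  shows "[geo s a = geo s b] (mod 2 ^ k) \<longleftrightarrow> [a = b] (mod 2 ^ k)"
proof (induction a b rule: linorder_wlog)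
  case (le a b)
  have "odd s" using assms by (rule odd_if_cong_1_mod_4)
  have "geo s b = geo s a + s ^ a * geo s (b - a)"
    using geo_add[of s a "b - a"] le by simp
  then have "[geo s a = geo s b] (mod 2 ^ k) \<longleftrightarrow> 2 ^ k dvd s ^ a * geo s (b - a)"
    by (metis cong_iff_dvd_diff cong_sym_eq add_diff_cancel_left')
  also have "\<dots> \<longleftrightarrow> 2 ^ k dvd b - a"
    using \<open>odd s\<close> by (simp add: pow2_dvd_odd_mult pow2_dvd_geo_iff[OF assms])
  also have "\<dots> \<longleftrightarrow> [a = b] (mod 2 ^ k)"
    using cong_altdef_nat[OF le, of "2 ^ k"] by (simp add: cong_sym_eq)
  finally show ?case .
next
  case (sym a b)
  then show ?case by (simp add: cong_sym_eq)
qed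

lemma geo_8_dvd:
  fixes s :: nat
  assumes "odd s"
  shows "8 dvd geo s 8"
proof -
  have even: "2 dvd geo x 2" if "odd x" for x :: nat
  proof -
    have "geo x 2 = 1 + x" by (simp add: geo_Suc numeral_2_eq_2)
    then show ?thesis using that by simp
  qed
  have "geo s (2 * (2 * 2)) = geo s 2 * (geo (s\<^sup>2) 2 * geo ((s\<^sup>2)\<^sup>2) 2)"
    unfolding geo_mult ..
  moreover have "2 * (2 * 2) dvd geo s 2 * (geo (s\<^sup>2) 2 * geo ((s\<^sup>2)\<^sup>2) 2)"
    using assms by (intro mult_dvd_mono even) simp_all
  ultimately show ?thesis by simp
qed

lemma two_pow_dvd_mult_geo_iff:
  fixes r s :: nat
  assumes "r = 2 ^ v * r'" "odd r'" "[s = 1] (mod 4)"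
  shows "2 ^ (v + w) dvd r * geo s i \<longleftrightarrow> 2 ^ w dvd i"
proof -
  have "2 ^ (v + w) dvd r * geo s i \<longleftrightarrow> 2 ^ w dvd r' * geo s i"
    using assms(1) by (simp add: power_add mult.assoc)
  also have "\<dots> \<longleftrightarrow> (2::int) ^ w dvd int (r' * geo s i)"
    by (metis of_nat_dvd_iff of_nat_numeral of_nat_power)
  also have "\<dots> \<longleftrightarrow> 2 ^ w dvd geo (int s) i"
    using assms(2) by (simp add: pow2_dvd_odd_mult of_nat_geo)
  also have "\<dots> \<longleftrightarrow> 2 ^ w dvd i"
    using assms(3) by (intro pow2_dvd_geo_iff) (simp flip: cong_int_iff)
  finally show ?thesis .
qed

text \<open>
  For \<open>t = 4 q c \<plusminus> 1\<close> with \<open>q = 2\<^sup>j\<close> and \<open>c\<close> odd, \<open>\<tau> = 1 + s + \<dots> + s\<^sup>t\<^sup>-\<^sup>1\<close> satisfies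
  \<open>\<tau> \<equiv> t\<close> modulo \<open>8 q\<close>, as both are congruent to \<open>4 q \<plusminus> 1\<close>, provided that \<open>s \<equiv> 1\<close> modulo \<open>4\<close>
  for the positive sign and modulo \<open>8 q\<close> for the negative sign.
\<close>

lemma geo_1_plus:
  fixes s :: int
  assumes s: "[s = 1] (mod 4)" and t: "t = 4 * 2 ^ j * c + 1" "odd c"
  shows "[geo s t = 1 + 4 * 2 ^ j] (mod 8 * 2 ^ j)"
proof -
  have "odd s" using s by (rule odd_if_cong_1_mod_4)
  have "2 ^ (j + 2) dvd geo s (4 * 2 ^ j * c)" "\<not> 2 ^ Suc (j + 2) dvd geo s (4 * 2 ^ j * c)"
    using t unfolding pow2_dvd_geo_iff[OF s] by (simp_all add: power_add mult.commute)
  then obtain d where d: "odd d" "geo s (4 * 2 ^ j * c) = 2 ^ (j + 2) * d"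
    by (rule pow2_dvd_exact)
  have "odd (s * d)" using \<open>odd s\<close> d by simp
  then obtain l where l: "s * d = 2 * l + 1" by (rule oddE)
  have "geo s t = 1 + 4 * 2 ^ j * (s * d)"
    unfolding t(1) using d by (simp add: geo_Suc' power_add mult_ac)
  also have "\<dots> = 1 + 4 * 2 ^ j + 8 * 2 ^ j * l"
    unfolding l by (simp add: algebra_simps)
  finally show ?thesis by (simp add: cong_def mod_simps)
qed

lemma geo_minus_1_plus:
  fixes s :: int
  assumes s: "[s = 1] (mod 8 * 2 ^ j)" and t: "t + 1 = 4 * 2 ^ j * c" "odd c"
  shows "[geo s t = 4 * 2 ^ j - 1] (mod 8 * 2 ^ j)"
proof -
  have s4: "[s = 1] (mod 4)"
    using s by (rule cong_dvd_modulus) simp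
  have "2 ^ (j + 2) dvd geo s (4 * 2 ^ j * c)" "\<not> 2 ^ Suc (j + 2) dvd geo s (4 * 2 ^ j * c)"
    using t unfolding pow2_dvd_geo_iff[OF s4] by (simp_all add: power_add mult.commute)
  then obtain d where d: "odd d" "geo s (4 * 2 ^ j * c) = 2 ^ (j + 2) * d"
    by (rule pow2_dvd_exact)
  obtain l where l: "d = 2 * l + 1" using d(1) by (rule oddE)
  have "geo s t = geo s (4 * 2 ^ j * c) - s ^ t"
    unfolding t(1)[symmetric] by (simp add: geo_Suc)
  also have "geo s (4 * 2 ^ j * c) = 4 * 2 ^ j + 8 * 2 ^ j * l"
    unfolding d l by (simp add: power_add algebra_simps)
  also have "[4 * 2 ^ j + 8 * 2 ^ j * l - s ^ t = 4 * 2 ^ j - 1 ^ t] (mod 8 * 2 ^ j)"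
    using s by (intro cong_diff cong_pow) (simp_all add: cong_def mod_simps)
  finally show ?thesis by simp
qed

lemma geo_4: "geo x 4 = 1 + x + x\<^sup>2 + x ^ 3"
  by (simp add: geo_def eval_nat_numeral lessThan_Suc algebra_simps)

text \<open>
  The value \<open>1 + \<tau> + \<tau>\<^sup>2 + \<tau>\<^sup>3\<close> modulo \<open>16 q\<close> depends only on \<open>\<tau>\<close> modulo \<open>8 q\<close>,
  because the derivative of the cubic is even at odd arguments.
\<close>

lemma geo_4_near_1:
  fixes x q :: int
  assumes "[x = 1 + 4 * q] (mod 8 * q)"
  shows "[geo x 4 = 4 + 8 * q] (mod 16 * q)"
proof -
  obtain l where "x = 1 + 4 * q + 8 * q * l"
    using assms by (metis cong_iff_lin cong_sym)
  then obtain d where d: "x = 1 + 4 * q * d" "d = 1 + 2 * l" by (simp add: algebra_simps)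
  have "geo x 4 - (4 + 8 * q) = 16 * q * (1 + 3 * l + 4 * q * d\<^sup>2 + 4 * q\<^sup>2 * d ^ 3)"
    unfolding geo_4 d by (simp add: power2_eq_square power3_eq_cube algebra_simps)
  then show ?thesis by (simp add: cong_iff_dvd_diff)
qed

lemma geo_4_near_minus_1:
  fixes x q :: int
  assumes "[x = 4 * q - 1] (mod 8 * q)"
  shows "[geo x 4 = 8 * q] (mod 16 * q)"
proof -
  obtain l where "x = 4 * q - 1 + 8 * q * l"
    using assms by (metis cong_iff_lin cong_sym)
  then obtain d where d: "x = 4 * q * d - 1" "d = 1 + 2 * l" by (simp add: algebra_simps)
  have "geo x 4 - 8 * q = 16 * q * (l - 2 * q * d\<^sup>2 + 4 * q\<^sup>2 * d ^ 3)"
    unfolding geo_4 d by (simp add: power2_eq_square power3_eq_cube algebra_simps)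
  then show ?thesis by (simp add: cong_iff_dvd_diff)
qed

section \<open>Solving the parameter congruences\<close>

lemma odd_half_modulus: "odd r \<Longrightarrow> [r * x = x] (mod 2 * x)" for r x :: int
  by (auto elim!: oddE simp: cong_iff_dvd_diff algebra_simps)

lemma cong_power_iff_dvd: "[s ^ Suc i = s] (mod 2 ^ e) \<longleftrightarrow> 2 ^ e dvd (s - 1) * geo s i"
  if "odd s" for s :: int
proof -
  have "s ^ Suc i - s = s * ((s - 1) * geo s i)"
    by (simp only: geo_telescope) (simp add: algebra_simps)
  then show ?thesis
    using that by (simp add: cong_iff_dvd_diff pow2_dvd_odd_mult del: power_Suc)
qed

text \<open>
  With \<open>r\<close> of valuation \<open>v\<close> and \<open>q = 2\<^sup>j\<close>, multiplying \<open>1 + \<tau> + \<tau>\<^sup>2 + \<tau>\<^sup>3 \<equiv> 4 + 8 q\<close> (respectively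
  \<open>8 q\<close>) modulo \<open>16 q\<close> by \<open>r\<close> gives the value of \<open>s - 1\<close> modulo \<open>2\<^sup>e\<close>, as \<open>8 q r \<equiv> 2\<^sup>e\<^sup>-\<^sup>1\<close>.
\<close>

lemma solutions_1_mod_4:
  fixes r s :: int
  assumes e: "e = v + j + 4" and r: "r = 2 ^ v * r'" "odd r'" and t: "t = 4 * 2 ^ j * c + 1" "odd c"
  shows "[s = 1] (mod 4) \<and> [s = 1 + r * geo (geo s t) 4] (mod 2 ^ e) \<and> [s ^ t = s] (mod 2 ^ e)
    \<longleftrightarrow> [s = 4 * r + 2 ^ (e - 1) + 1] (mod 2 ^ e)"
proof -
  have e_eq: "(2::int) ^ e = 2 ^ v * (16 * 2 ^ j)" "(2::int) ^ (e - 1) = 2 ^ v * (8 * 2 ^ j)"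
    unfolding e by (simp_all add: power_add)
  then have e_half: "(2::int) ^ e = 2 * 2 ^ (e - 1)" by simp
  have val: "[1 + r * geo (geo s t) 4 = 4 * r + 2 ^ (e - 1) + 1] (mod 2 ^ e)" if "[s = 1] (mod 4)"
  proof -
    have "[geo (geo s t) 4 = 4 + 8 * 2 ^ j] (mod 16 * 2 ^ j)"
      by (rule geo_4_near_1[OF geo_1_plus[OF that t]])
    then have "[2 ^ v * geo (geo s t) 4 = 2 ^ v * (4 + 8 * 2 ^ j)] (mod 2 ^ e)"
      unfolding e_eq by (rule cong_cmult_leftI)
    then have "[r' * (2 ^ v * geo (geo s t) 4) = r' * (2 ^ v * (4 + 8 * 2 ^ j))] (mod 2 ^ e)"
      by (rule cong_scalar_left)
    also have "r' * (2 ^ v * (4 + 8 * 2 ^ j)) = 4 * r + r' * 2 ^ (e - 1)"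
      unfolding e_eq r by (simp add: algebra_simps)
    also have "[4 * r + r' * 2 ^ (e - 1) = 4 * r + 2 ^ (e - 1)] (mod 2 ^ e)"
      unfolding e_half by (intro cong_add cong_refl odd_half_modulus r)
    finally show ?thesis
      unfolding r by (simp add: cong_add_lcancel algebra_simps)
  qed
  show ?thesis
  proof
    assume "[s = 1] (mod 4) \<and> [s = 1 + r * geo (geo s t) 4] (mod 2 ^ e) \<and> [s ^ t = s] (mod 2 ^ e)"
    then show "[s = 4 * r + 2 ^ (e - 1) + 1] (mod 2 ^ e)"
      using val cong_trans by blast
  next
    assume s: "[s = 4 * r + 2 ^ (e - 1) + 1] (mod 2 ^ e)"
    then obtain l where l: "s = 4 * r + 2 ^ (e - 1) + 1 + 2 ^ e * l"
      by (metis cong_iff_lin cong_sym)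
    then have s1: "s - 1 = 2 ^ (v + 2) * (r' + 2 * 2 ^ j + 4 * 2 ^ j * l)"
      unfolding e_eq r by (simp add: power_add algebra_simps)
    then have s4: "[s = 1] (mod 4)"
      by (simp add: cong_iff_dvd_diff power_add)
    then have "odd s" by (rule odd_if_cong_1_mod_4)
    have "2 ^ (j + 2) dvd geo s (4 * 2 ^ j * c)"
      unfolding pow2_dvd_geo_iff[OF s4] by (simp add: power_add)
    then have "2 ^ (v + 2) * 2 ^ (j + 2) dvd (s - 1) * geo s (4 * 2 ^ j * c)"
      unfolding s1 by (intro mult_dvd_mono) auto
    then have "2 ^ e dvd (s - 1) * geo s (4 * 2 ^ j * c)"
      unfolding e by (simp add: power_add mult_ac)
    then have "[s ^ t = s] (mod 2 ^ e)"
      using cong_power_iff_dvd[OF \<open>odd s\<close>] t by simp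
    moreover have "[s = 1 + r * geo (geo s t) 4] (mod 2 ^ e)"
      using s val[OF s4] by (metis cong_sym cong_trans)
    ultimately show "[s = 1] (mod 4) \<and> [s = 1 + r * geo (geo s t) 4] (mod 2 ^ e) \<and> [s ^ t = s] (mod 2 ^ e)"
      using s4 by blast
  qed
qed

text \<open>
  Here the congruence \<open>s\<^sup>t \<equiv> s\<close> is used as well: \<open>t - 1\<close> is twice an odd number, so it forces
  \<open>s \<equiv> 1\<close> modulo \<open>2\<^sup>e\<^sup>-\<^sup>1\<close>.
\<close>

lemma solutions_3_mod_4:
  fixes r s :: int
  assumes e: "e = v + j + 4" and r: "r = 2 ^ v * r'" "odd r'" and t: "t + 1 = 4 * 2 ^ j * c" "odd c"
  shows "[s = 1] (mod 4) \<and> [s = 1 + r * geo (geo s t) 4] (mod 2 ^ e) \<and> [s ^ t = s] (mod 2 ^ e)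
    \<longleftrightarrow> [s = 2 ^ (e - 1) + 1] (mod 2 ^ e)"
proof -
  have e_eq: "(2::int) ^ e = 2 ^ v * (16 * 2 ^ j)" "(2::int) ^ (e - 1) = 2 ^ v * (8 * 2 ^ j)"
    unfolding e by (simp_all add: power_add)
  then have e_half: "(2::int) ^ e = 2 * 2 ^ (e - 1)" by simp
  obtain i where i: "t = Suc (2 * i)" "even i \<longleftrightarrow> False"
  proof -
    have "c > 0" using t(2) by (auto intro: gr0I)
    then obtain b where "2 ^ j * c = Suc b" by (metis gr0_implies_Suc mult_pos_pos zero_less_numeral zero_less_power)
    then have "t = Suc (2 * (2 * b + 1))" using t(1) by simp
    then show ?thesis using that[of "2 * b + 1"] by simp
  qed
  have val: "[1 + r * geo (geo s t) 4 = 2 ^ (e - 1) + 1] (mod 2 ^ e)" if "2 ^ (e - 1) dvd s - 1"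
  proof -
    have "[s = 1] (mod 8 * 2 ^ j)"
      using that unfolding e_eq cong_iff_dvd_diff by (rule dvd_mult_right)
    then have "[geo (geo s t) 4 = 8 * 2 ^ j] (mod 16 * 2 ^ j)"
      by (rule geo_4_near_minus_1[OF geo_minus_1_plus[OF _ t]])
    then have "[2 ^ v * geo (geo s t) 4 = 2 ^ v * (8 * 2 ^ j)] (mod 2 ^ e)"
      unfolding e_eq by (rule cong_cmult_leftI)
    then have "[r' * (2 ^ v * geo (geo s t) 4) = r' * 2 ^ (e - 1)] (mod 2 ^ e)"
      unfolding e_eq by (rule cong_scalar_left)
    also have "[r' * 2 ^ (e - 1) = 2 ^ (e - 1)] (mod 2 ^ e)"
      unfolding e_half by (intro odd_half_modulus r)
    finally show ?thesis
      unfolding r by (simp add: cong_add_lcancel algebra_simps)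
  qed
  show ?thesis
  proof
    assume *: "[s = 1] (mod 4) \<and> [s = 1 + r * geo (geo s t) 4] (mod 2 ^ e) \<and> [s ^ t = s] (mod 2 ^ e)"
    then have "odd s" using odd_if_cong_1_mod_4 by blast
    have "2 ^ 1 dvd geo s (2 * i)" "\<not> 2 ^ Suc 1 dvd geo s (2 * i)"
      using * i unfolding pow2_dvd_geo_iff[OF conjunct1[OF *]] by auto
    then obtain d where d: "odd d" "geo s (2 * i) = 2 ^ 1 * d"
      by (rule pow2_dvd_exact)
    have "2 ^ e dvd (s - 1) * geo s (2 * i)"
      using * cong_power_iff_dvd[OF \<open>odd s\<close>] i by simp
    also have "(s - 1) * geo s (2 * i) = 2 * (d * (s - 1))"
      using d by simp
    also have "2 ^ e = 2 * (2::int) ^ (e - 1)"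
      unfolding e by (simp add: power_add)
    finally have "2 ^ (e - 1) dvd s - 1"
      using d by (simp add: pow2_dvd_odd_mult)
    with * val show "[s = 2 ^ (e - 1) + 1] (mod 2 ^ e)"
      using cong_trans by blast
  next
    assume s: "[s = 2 ^ (e - 1) + 1] (mod 2 ^ e)"
    then obtain l where l: "s = 2 ^ (e - 1) + 1 + 2 ^ e * l"
      by (metis cong_iff_lin cong_sym)
    then have s1: "s - 1 = 2 ^ (e - 1) * (1 + 2 * l)"
      unfolding e_eq by (simp add: algebra_simps)
    then have s4: "[s = 1] (mod 4)"
      unfolding e_eq by (simp add: cong_iff_dvd_diff)
    then have "odd s" by (rule odd_if_cong_1_mod_4)
    have "2 ^ 1 dvd geo s (2 * i)"
      unfolding pow2_dvd_geo_iff[OF s4] by simp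
    then have "2 ^ (e - 1) * 2 ^ 1 dvd (s - 1) * geo s (2 * i)"
      unfolding s1 by (intro mult_dvd_mono) auto
    then have "2 ^ e dvd (s - 1) * geo s (2 * i)"
      unfolding e_eq by (simp add: mult_ac)
    then have "[s ^ t = s] (mod 2 ^ e)"
      using cong_power_iff_dvd[OF \<open>odd s\<close>] i by simp
    moreover have "2 ^ (e - 1) dvd s - 1"
      unfolding s1 by simp
    then have "[s = 1 + r * geo (geo s t) 4] (mod 2 ^ e)"
      by (rule cong_trans[OF s cong_sym[OF val]])
    ultimately show "[s = 1] (mod 4) \<and> [s = 1 + r * geo (geo s t) 4] (mod 2 ^ e) \<and> [s ^ t = s] (mod 2 ^ e)"
      using s4 by blast
  qed
qed

section \<open>Elements of order four modulo a power of two\<close>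

lemma ord_eq_4I:
  fixes t :: nat
  assumes "[(int t)\<^sup>2 = 1 + 8 * 2 ^ j] (mod 16 * 2 ^ j)"
  shows "ord (2 ^ (j + 4)) t = 4"
proof -
  have pow: "[t ^ i = 1] (mod 2 ^ (j + 4)) \<longleftrightarrow> [(int t) ^ i = 1] (mod 16 * 2 ^ j)" for i
    by (simp add: power_add mult.commute flip: cong_int_iff)
  have "[((int t)\<^sup>2)\<^sup>2 = (1 + 8 * 2 ^ j)\<^sup>2] (mod 16 * 2 ^ j)"
    using assms by (rule cong_pow)
  also have "(1 + 8 * 2 ^ j)\<^sup>2 = 1 + 16 * 2 ^ j * (1 + 4 * 2 ^ j :: int)"
    by (simp add: power2_eq_square algebra_simps)
  also have "[\<dots> = 1] (mod 16 * 2 ^ j)"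
    by (simp add: cong_iff_dvd_diff)
  finally have "ord (2 ^ (j + 4)) t dvd 4"
    unfolding ord_divides[symmetric] pow by (simp flip: power_mult)
  moreover have "\<not> [(int t)\<^sup>2 = 1] (mod 16 * 2 ^ j)"
  proof
    assume "[(int t)\<^sup>2 = 1] (mod 16 * 2 ^ j)"
    with assms have "[1 + 8 * 2 ^ j = 1 :: int] (mod 16 * 2 ^ j)"
      by (metis cong_sym cong_trans)
    then have "16 * 2 ^ j dvd (8 * 2 ^ j :: int)" by (simp add: cong_iff_dvd_diff)
    then show False by (auto dest!: zdvd_imp_le)
  qed
  then have "\<not> ord (2 ^ (j + 4)) t dvd 2"
    unfolding ord_divides[symmetric] pow .
  moreover have "d = 4" if "d dvd 4" "\<not> d dvd 2" for d :: nat
  proof -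
    have "d \<le> 4" using that by (auto dest: dvd_imp_le)
    then have "d \<in> {0,1,2,3,4}" by auto
    with that show ?thesis by auto
  qed
  ultimately show ?thesis by blast
qed

text \<open>
  With \<open>q = 2\<^sup>j\<close>, the classes of order \<open>4\<close> modulo \<open>16 q\<close> are \<open>4 q \<plusminus> 1\<close> and \<open>12 q \<plusminus> 1\<close>.
\<close>

lemma ord_eq_4_iff:
  fixes t :: nat
  assumes "t < 16 * 2 ^ j"
  shows "ord (2 ^ (j + 4)) t = 4 \<longleftrightarrow>
    (\<exists>c\<in>{1, 3}. t = 4 * 2 ^ j * c + 1 \<or> t + 1 = 4 * 2 ^ j * c)"
proof
  assume "\<exists>c\<in>{1, 3}. t = 4 * 2 ^ j * c + 1 \<or> t + 1 = 4 * 2 ^ j * c"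
  then obtain c where "c \<in> {1, 3}" and t: "t = 4 * 2 ^ j * c + 1 \<or> t + 1 = 4 * 2 ^ j * c" by blast
  then have c: "odd c" by auto
  define q :: int where "q = 2 ^ j"
  obtain l where l: "int c = 1 + 2 * l"
    using c by (metis add.commute even_of_nat oddE)
  consider "int t = 4 * q * (1 + 2 * l) + 1" | "int t = 4 * q * (1 + 2 * l) - 1"
  proof -
    have "int t = 4 * q * int c + 1 \<or> int t = 4 * q * int c - 1"
    proof -
      have "int t = int (4 * 2 ^ j * c + 1) \<or> int (t + 1) = int (4 * 2 ^ j * c)"
        using t by presburger
      then show ?thesis by (auto simp: q_def)
    qed
    then show ?thesis using that l by metis
  qed
  then have "[(int t)\<^sup>2 = 1 + 8 * q] (mod 16 * q)"
  proof cases
    case 1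
    have "(int t)\<^sup>2 - (1 + 8 * q) = 16 * q * (l + q * (1 + 2 * l)\<^sup>2)"
      unfolding 1 by (simp add: power2_eq_square algebra_simps)
    then show ?thesis by (simp add: cong_iff_dvd_diff)
  next
    case 2
    have "(int t)\<^sup>2 - (1 + 8 * q) = 16 * q * (q * (1 + 2 * l)\<^sup>2 - l - 1)"
      unfolding 2 by (simp add: power2_eq_square algebra_simps)
    then show ?thesis by (simp add: cong_iff_dvd_diff)
  qed
  then show "ord (2 ^ (j + 4)) t = 4"
    unfolding q_def by (rule ord_eq_4I)
next
  assume ord: "ord (2 ^ (j + 4)) t = 4"
  define q :: nat where "q = 2 ^ j"
  have pow: "[t ^ i = 1] (mod 2 ^ (j + 4)) \<longleftrightarrow> 2 ^ (j + 4) dvd (int t) ^ i - 1" for i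
    by (simp add: cong_iff_dvd_diff flip: cong_int_iff)
  have "coprime (2 ^ (j + 4)) t"
    using ord by (metis ord_eq_0 zero_neq_numeral)
  then have "odd t" by simp
  then obtain a where a: "int t = 2 * a + 1" by (metis even_of_nat oddE)
  have "2 ^ (j + 4) dvd (int t) ^ 4 - 1"
    unfolding pow[symmetric] ord_divides ord by simp
  also have "(int t) ^ 4 - 1 = 8 * ((1 + 2 * (a + a\<^sup>2)) * (a * (a + 1)))"
    unfolding a by (simp add: eval_nat_numeral algebra_simps)
  also have "(2::int) ^ (j + 4) = 8 * 2 ^ (j + 1)"
    by (simp add: power_add)
  finally have "2 ^ (j + 1) dvd (1 + 2 * (a + a\<^sup>2)) * (a * (a + 1))"
    by (rule dvd_times_left_cancel_iff[THEN iffD1, rotated]) simp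
  then have dvd: "2 ^ (j + 1) dvd a * (a + 1)"
    by (subst (asm) pow2_dvd_odd_mult) auto
  have not_dvd: "\<not> 2 ^ Suc (j + 1) dvd a * (a + 1)"
  proof
    assume "2 ^ Suc (j + 1) dvd a * (a + 1)"
    then have "4 * 2 ^ Suc (j + 1) dvd 4 * (a * (a + 1))" by (intro mult_dvd_mono dvd_refl)
    also have "4 * (a * (a + 1)) = (int t)\<^sup>2 - 1"
      unfolding a by (simp add: power2_eq_square algebra_simps)
    finally have "2 ^ (j + 4) dvd (int t)\<^sup>2 - 1" by (simp add: power_add mult_ac)
    then show False
      unfolding pow[symmetric] ord_divides ord by simp
  qed
  show "\<exists>c\<in>{1, 3}. t = 4 * 2 ^ j * c + 1 \<or> t + 1 = 4 * 2 ^ j * c"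
  proof (cases "even a")
    case True
    then have "odd (a + 1)" by simp
    have "2 ^ (j + 1) dvd a" "\<not> 2 ^ Suc (j + 1) dvd a"
      using dvd not_dvd unfolding mult.commute[of a] pow2_dvd_odd_mult[OF \<open>odd (a + 1)\<close>] .
    then obtain c where c: "odd c" "a = 2 ^ (j + 1) * c" by (rule pow2_dvd_exact)
    then have t: "int t = 4 * (int q * c) + 1" unfolding a by (simp add: q_def)
    have q: "int q > 0" by (simp add: q_def)
    have "t < 16 * q" using assms unfolding q_def .
    then have "int q * (-1) < int q * c" "int q * c < int q * 4"
      using t q by linarith+
    then have "c > -1 \<and> c < 4" unfolding mult_less_cancel_left_pos[OF q] by simp
    with c(1) have "c = 1 \<or> c = 3" by presburger
    then have "t = 4 * q * 1 + 1 \<or> t = 4 * q * 3 + 1" using t by auto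
    then show ?thesis unfolding q_def by blast
  next
    case False
    have "2 ^ (j + 1) dvd a + 1" "\<not> 2 ^ Suc (j + 1) dvd a + 1"
      using dvd not_dvd unfolding pow2_dvd_odd_mult[OF False] .
    then obtain c where c: "odd c" "a + 1 = 2 ^ (j + 1) * c" by (rule pow2_dvd_exact)
    then have t: "int t = 4 * (int q * c) - 1" using a by (simp add: q_def)
    have q: "int q > 0" by (simp add: q_def)
    have "t < 16 * q" using assms unfolding q_def .
    then have "int q * (-1) < int q * c" "int q * c < int q * 5"
      using t q by linarith+
    then have "c > -1 \<and> c < 5" unfolding mult_less_cancel_left_pos[OF q] by simp
    with c(1) have "c = 1 \<or> c = 3" by presburger
    then have "t + 1 = 4 * q * 1 \<or> t + 1 = 4 * q * 3" using t by auto
    then show ?thesis unfolding q_def by blast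
  qed
qed

section \<open>Admissible triples\<close>

text \<open>
  The value of \<open>s\<close> in an admissible triple, which is determined by \<open>r\<close> and by the class of \<open>t\<close> modulo \<open>4\<close>.
\<close>

definition triple_s :: "nat \<Rightarrow> nat \<Rightarrow> nat \<Rightarrow> nat" where
  "triple_s e r t = (if [t = 1] (mod 4) then 4 * r + 2 ^ (e - 1) + 1 else 2 ^ (e - 1) + 1)"

lemma param_conditions_iff:
  fixes r s t :: nat
  assumes e: "e = v + j + 4" and r: "r = 2 ^ v * r'" "odd r'"
    and t: "t < 2 ^ (j + 4)" "ord (2 ^ (j + 4)) t = 4"
  shows "[s = 1] (mod 4) \<and> [s = 1 + r * geo (geo s t) 4] (mod 2 ^ e) \<and> [s ^ t = s] (mod 2 ^ e)
    \<longleftrightarrow> [s = triple_s e r t] (mod 2 ^ e)"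
proof -
  have to_int: "[s = 1] (mod 4) \<longleftrightarrow> [int s = 1] (mod 4)"
    "[s = 1 + r * geo (geo s t) 4] (mod 2 ^ e) \<longleftrightarrow>
      [int s = 1 + int r * geo (geo (int s) t) 4] (mod 2 ^ e)"
    "[s ^ t = s] (mod 2 ^ e) \<longleftrightarrow> [int s ^ t = int s] (mod 2 ^ e)"
    "[s = 4 * r + 2 ^ (e - 1) + 1] (mod 2 ^ e) \<longleftrightarrow> [int s = 4 * int r + 2 ^ (e - 1) + 1] (mod 2 ^ e)"
    "[s = 2 ^ (e - 1) + 1] (mod 2 ^ e) \<longleftrightarrow> [int s = 2 ^ (e - 1) + 1] (mod 2 ^ e)"
    by (simp_all add: of_nat_geo add_ac flip: cong_int_iff)
  have r_int: "int r = 2 ^ v * int r'" "odd (int r')"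
    using r by simp_all
  have "t < 16 * 2 ^ j" using t(1) by (simp add: power_add)
  then obtain c where c: "c \<in> {1, 3}" and "t = 4 * 2 ^ j * c + 1 \<or> t + 1 = 4 * 2 ^ j * c"
    using t(2) ord_eq_4_iff by blast
  then consider "t = 4 * 2 ^ j * c + 1" | "t + 1 = 4 * 2 ^ j * c" by blast
  then show ?thesis
  proof cases
    case 1
    then have "t = 4 * (2 ^ j * c) + 1" by simp
    then have "[t = 1] (mod 4)" unfolding cong_def by presburger
    then have "triple_s e r t = 4 * r + 2 ^ (e - 1) + 1"
      by (simp add: triple_s_def)
    moreover have c: "odd c" using c by auto
    ultimately show ?thesis
      using solutions_1_mod_4[OF e r_int 1 c, of "int s"] by (simp only: to_int)
  next
    case 2
    then have "4 dvd t + 1" by simp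
    then have "\<not> [t = 1] (mod 4)" unfolding cong_def by presburger
    then have "triple_s e r t = 2 ^ (e - 1) + 1"
      by (simp add: triple_s_def)
    moreover have c: "odd c" using c by auto
    ultimately show ?thesis
      using solutions_3_mod_4[OF e r_int 2 c, of "int s"] by (simp only: to_int)
  qed
qed

lemma admissible_triples_iff:
  assumes e: "e \<ge> 4"
  shows "(r, s, t) \<in> admissible_triples e \<longleftrightarrow>
    r < 2 ^ e \<and> \<not> 2 ^ (e - 3) dvd r \<and>
    t < 2 ^ (e - multiplicity 2 r) \<and> ord (2 ^ (e - multiplicity 2 r)) t = 4 \<and> s = triple_s e r t"
proof -
  define v where "v = multiplicity 2 r"
  have r_iff: "r \<noteq> 0 \<and> v \<le> e - 4 \<longleftrightarrow> \<not> 2 ^ (e - 3) dvd r"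
  proof (cases "r = 0")
    case False
    then have "2 ^ (e - 3) dvd r \<longleftrightarrow> e - 3 \<le> v"
      unfolding v_def by (intro power_dvd_iff_le_multiplicity) auto
    with False e show ?thesis by auto
  qed auto
  have st_iff: "ord (2 ^ (e - v)) t = 4 \<and>
     ((s = 4 * r + 2 ^ (e - 1) + 1 \<and> (t = 2 ^ (e - v - 2) + 1 \<or> t = 3 * 2 ^ (e - v - 2) + 1)) \<or>
      (s = 2 ^ (e - 1) + 1 \<and> (t = 2 ^ (e - v - 2) - 1 \<or> t = 3 * 2 ^ (e - v - 2) - 1)))
    \<longleftrightarrow> t < 2 ^ (e - v) \<and> ord (2 ^ (e - v)) t = 4 \<and> s = triple_s e r t" if "v \<le> e - 4"
  proof -
    have "e = v + (e - v - 4) + 4" using that e by linarith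
    then obtain j where j: "e = v + j + 4" by blast
    define q :: nat where "q = 2 ^ j"
    have "q > 0" by (simp add: q_def)
    have pow: "e - v = j + 4" "2 ^ (e - v - 2) = 4 * q" "2 ^ (e - v) = 16 * q"
    proof -
      have ev: "e - v = j + 4" "e - v - 2 = j + 2" using j by linarith+
      show "e - v = j + 4" "2 ^ (e - v - 2) = 4 * q" "2 ^ (e - v) = 16 * q"
        unfolding ev q_def by (simp_all add: power_add)
    qed
    have mod1: "[t = 1] (mod 4)" if "t = 4 * q + 1 \<or> t = 3 * (4 * q) + 1"
    proof -
      have "t = 4 * q + 1 \<or> t = 4 * (3 * q) + 1"
        using that by linarith
      then obtain x where "t = 4 * x + 1" by blast
      then show ?thesis unfolding cong_def by presburger
    qed
    have mod3: "\<not> [t = 1] (mod 4)" if "t = 4 * q - 1 \<or> t = 3 * (4 * q) - 1"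
    proof -
      have "t + 1 = 4 * q \<or> t + 1 = 4 * (3 * q)"
        using that \<open>q > 0\<close> by linarith
      then have "4 dvd t + 1" by (metis dvd_triv_left)
      then show ?thesis unfolding cong_def by presburger
    qed
    have ord: "t < 16 * q \<and> ord (16 * q) t = 4 \<longleftrightarrow>
      t = 4 * q + 1 \<or> t = 3 * (4 * q) + 1 \<or> t = 4 * q - 1 \<or> t = 3 * (4 * q) - 1"
    proof -
      have pow_j: "(2::nat) ^ (j + 4) = 16 * q" by (simp add: q_def power_add)
      have "ord (2 ^ (j + 4)) t = 4 \<longleftrightarrow> (\<exists>c\<in>{1, 3}. t = 4 * q * c + 1 \<or> t + 1 = 4 * q * c)" if "t < 16 * q"
        using ord_eq_4_iff[of t j] that unfolding q_def by (simp only:)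
      then have "t < 16 * q \<and> ord (16 * q) t = 4 \<longleftrightarrow>
          t < 16 * q \<and> (\<exists>c\<in>{1, 3}. t = 4 * q * c + 1 \<or> t + 1 = 4 * q * c)"
        unfolding pow_j by (rule conj_cong[OF refl])
      then show ?thesis using \<open>q > 0\<close> by auto
    qed
    show ?thesis
    proof (cases "[t = 1] (mod 4)")
      case True
      then have "triple_s e r t = 4 * r + 2 ^ (e - 1) + 1" by (simp add: triple_s_def)
      with True show ?thesis
        unfolding pow(2,3) using ord mod3 by auto
    next
      case False
      then have "triple_s e r t = 2 ^ (e - 1) + 1" by (simp add: triple_s_def)
      with False show ?thesis
        unfolding pow(2,3) using ord mod1 by auto
    qed
  qed
  show ?thesis
    unfolding admissible_triples_def mem_Collect_eq prod.case v_def[symmetric]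
    using r_iff st_iff by blast
qed

text \<open>
  All \<open>r < 2\<^sup>e\<close> occur except the eight multiples of \<open>2\<^sup>e\<^sup>-\<^sup>3\<close>, each with four values of \<open>t\<close>.
\<close>

lemma card_admissible_triples:
  assumes e: "e \<ge> 4"
  shows "card (admissible_triples e) = 2 ^ (e + 2) - 32"
proof -
  have pow_e: "(2::nat) ^ e = 2 ^ (e - 3) * 8"
  proof -
    have "(2::nat) ^ e = 2 ^ (e - 3 + 3)" using e by simp
    then show ?thesis by (simp only: power_add) simp
  qed
  define R where "R = {r. r < 2 ^ e \<and> \<not> 2 ^ (e - 3) dvd (r :: nat)}"
  define T where "T r = {t. t < 2 ^ (e - multiplicity 2 r) \<and> ord (2 ^ (e - multiplicity 2 r)) (t :: nat) = 4}" for r :: nat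
  have "admissible_triples e = (\<lambda>(r, t). (r, triple_s e r t, t)) ` Sigma R T"
    using admissible_triples_iff[OF e] by (force simp: R_def T_def)
  moreover have "inj_on (\<lambda>(r, t). (r, triple_s e r t, t)) (Sigma R T)"
    by (auto simp: inj_on_def)
  moreover have finR: "finite R" and finT: "finite (T r)" for r
    by (auto simp: R_def T_def)
  ultimately have card: "card (admissible_triples e) = (\<Sum>r\<in>R. card (T r))"
    by (simp add: card_image card_SigmaI)
  have "card (T r) = 4" if "r \<in> R" for r
  proof -
    have "r \<noteq> 0" "\<not> 2 ^ (e - 3) dvd r" using that by (auto simp: R_def intro: gr0I)
    then have "multiplicity 2 r < e - 3"
      by (subst (asm) power_dvd_iff_le_multiplicity) auto
    then have "e - multiplicity 2 r = (e - multiplicity 2 r - 4) + 4" by linarith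
    then obtain j where j: "e - multiplicity 2 r = j + 4" by blast
    define q :: nat where "q = 2 ^ j"
    have "q > 0" by (simp add: q_def)
    have "T r = {t. t < 16 * q \<and> (\<exists>c\<in>{1, 3}. t = 4 * q * c + 1 \<or> t + 1 = 4 * q * c)}"
      unfolding T_def j using ord_eq_4_iff[of _ j] by (auto simp: q_def power_add mult.commute)
    also have "\<dots> = {4 * q + 1, 12 * q + 1, 4 * q - 1, 12 * q - 1}"
      using \<open>q > 0\<close> by auto
    also have "card \<dots> = 4"
    proof -
      obtain b where "q = Suc b" using \<open>q > 0\<close> gr0_implies_Suc by blast
      then have "{4 * q + 1, 12 * q + 1, 4 * q - 1, 12 * q - 1} = {4 * b + 5, 12 * b + 13, 4 * b + 3, 12 * b + 11}"
        by (simp add: add_ac)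
      moreover have "card {4 * b + 5, 12 * b + 13, 4 * b + 3, 12 * b + 11} = 4"
        by (subst card_insert_disjoint; simp; presburger?)+
      ultimately show ?thesis by simp
    qed
    finally show ?thesis .
  qed
  then have "card (admissible_triples e) = 4 * card R"
    using card by simp
  also have "R = {..<2 ^ e} - (\<lambda>i. 2 ^ (e - 3) * i) ` {..<8}"
  proof -
    show ?thesis using pow_e by (auto simp: R_def)
  qed
  also have "card \<dots> = 2 ^ e - 8"
  proof -
    have "(\<lambda>i. 2 ^ (e - 3) * i) ` {..<8} \<subseteq> {..<2 ^ e :: nat}"
      using pow_e by auto
    then show ?thesis
      by (simp add: card_Diff_subset card_image inj_on_def)
  qed
  finally show ?thesis
    by (simp add: power_add)
qed

section \<open>Triples and skew morphisms\<close>

lemma given_by_triple_iff: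
  "given_by_triple e \<phi> (r, s, t) \<longleftrightarrow>
    (\<forall>x. \<phi> (int (x mod 2 ^ (e + 2))) = int (param_map 4 r s t x mod 2 ^ (e + 2)))"
  unfolding given_by_triple_def prod.case unfolding geo_eq_sum_from_1[symmetric] param_map_def
  by (simp add: geo_def zmod_int mult.assoc)

lemma admissible_triplesE:
  assumes e: "e \<ge> 4" and adm: "(r, s, t) \<in> admissible_triples e"
  obtains v j r' where "v = multiplicity 2 r" "e = v + j + 4" "r = 2 ^ v * r'" "odd r'" "r < 2 ^ e"
    "t < 2 ^ (j + 4)" "ord (2 ^ (j + 4)) t = 4" "s = triple_s e r t"
proof -
  define v where "v = multiplicity 2 r"
  have r: "r < 2 ^ e" "\<not> 2 ^ (e - 3) dvd r" and
    t: "t < 2 ^ (e - v)" "ord (2 ^ (e - v)) t = 4" "s = triple_s e r t"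
    using adm unfolding admissible_triples_iff[OF e] v_def by auto
  have "r \<noteq> 0" using r(2) by (auto intro: gr0I)
  then have "v < e - 3"
    using r(2) unfolding v_def by (subst (asm) power_dvd_iff_le_multiplicity) auto
  then have "e = v + (e - v - 4) + 4" by linarith
  moreover obtain r' where "r = 2 ^ v * r'" "odd r'"
    using \<open>r \<noteq> 0\<close> multiplicity_decompose'[of r 2] unfolding v_def by auto
  moreover have "e - v = (e - v - 4) + 4" using \<open>v < e - 3\<close> by linarith
  ultimately show ?thesis using r t that[OF v_def] by metis
qed

lemma admissible_triple_skew_params:
  assumes e: "e \<ge> 4" and adm: "(r, s, t) \<in> admissible_triples e"
  obtains m where "skew_params 4 (2 ^ e) m r s t"
proof -
  obtain v j r' where *: "e = v + j + 4" "r = 2 ^ v * r'" "odd r'"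
    "t < 2 ^ (j + 4)" "ord (2 ^ (j + 4)) t = 4" and s: "s = triple_s e r t"
    using admissible_triplesE[OF assms] by metis
  have conds: "[s = 1] (mod 4)" "[s = 1 + r * geo (geo s t) 4] (mod 2 ^ e)" "[s ^ t = s] (mod 2 ^ e)"
    using param_conditions_iff[OF *, of s] s by auto
  have "skew_params 4 (2 ^ e) (2 ^ (j + 4)) r s t"
  proof
    show "2 ^ e dvd r * geo s i \<longleftrightarrow> 2 ^ (j + 4) dvd i" for i
      using two_pow_dvd_mult_geo_iff[OF *(2,3) conds(1), of "j + 4" i] *(1) by (simp add: add.assoc)
  qed (use conds * in auto)
  then show ?thesis by (rule that)
qed

lemma ex1_morphism_of_admissible_triple:
  assumes e: "e \<ge> 4" and adm: "p \<in> admissible_triples e"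
  shows "\<exists>!\<phi>. \<phi> \<in> smooth_skew_morphisms_of_type (integer_mod_group (2 ^ (e + 2))) 4 \<and> given_by_triple e \<phi> p"
proof -
  obtain r s t where p: "p = (r, s, t)" by (cases p)
  obtain m where "skew_params 4 (2 ^ e) m r s t"
    using admissible_triple_skew_params[OF e] adm p by metis
  then interpret skew_params 4 "2 ^ e" m r s t .
  have n: "4 * 2 ^ e = (2::nat) ^ (e + 2)" by (simp add: power_add)
  let ?G = "integer_mod_group (2 ^ (e + 2))"
  show ?thesis
  proof (rule ex1I)
    show "skew_map \<in> smooth_skew_morphisms_of_type ?G 4 \<and> given_by_triple e skew_map p"
      using skew_map_smooth skew_map_lift unfolding p given_by_triple_iff n by blast
    fix \<psi> assume \<psi>: "\<psi> \<in> smooth_skew_morphisms_of_type ?G 4 \<and> given_by_triple e \<psi> p"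
    then have "\<psi> \<in> extensional (carrier ?G)"
      by (auto simp: smooth_skew_morphisms_of_type_def smooth_skew_morphism_def skew_morphism_def
          carrier_BijGroup Bij_def)
    moreover have "skew_map \<in> extensional (carrier ?G)"
      unfolding skew_map_def n by simp
    moreover have "\<psi> x = skew_map x" if "x \<in> carrier ?G" for x
    proof -
      obtain a where "a < 2 ^ (e + 2)" "x = int a"
        by (rule carrier_integer_mod_group_cases[OF _ \<open>x \<in> carrier ?G\<close>]) auto
      then show ?thesis
        using \<psi> skew_map_lift[of a] unfolding p given_by_triple_iff n by (metis mod_less)
    qed
    ultimately show "\<psi> = skew_map" by (rule extensionalityI)
  qed
qed

text \<open>
  The values of \<open>\<phi>\<close> at \<open>1\<close> and \<open>2\<close> already determine the triple: the first gives \<open>r\<close>, and the second gives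
  \<open>\<tau>\<close> modulo \<open>2\<^bsup>e - v\<^esup>\<close> with \<open>v = \<nu>\<^sub>2(r)\<close>, hence \<open>t\<close> modulo \<open>4\<close>, hence \<open>s\<close>, hence \<open>t\<close>.
\<close>

lemma admissible_triple_unique:
  assumes e: "e \<ge> 4" and adm: "p \<in> admissible_triples e" "p' \<in> admissible_triples e"
    and given: "given_by_triple e \<phi> p" "given_by_triple e \<phi> p'"
  shows "p = p'"
proof -
  obtain r s t where p: "p = (r, s, t)" by (cases p)
  obtain r2 s2 t2 where p2: "p' = (r2, s2, t2)" by (cases p')
  have same: "[param_map 4 r s t x = param_map 4 r2 s2 t2 x] (mod (4 * 2 ^ e))" for x
    using given unfolding p p2 given_by_triple_iff
    by (simp add: cong_def power_add mult.commute del: of_nat_mod)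
  obtain v j r' where *: "e = v + j + 4" "r = 2 ^ v * r'" "odd r'"
    "t < 2 ^ (j + 4)" "ord (2 ^ (j + 4)) t = 4" and s: "s = triple_s e r t" and r: "r < 2 ^ e"
    and v: "v = multiplicity 2 r"
    using admissible_triplesE[OF e] adm(1) p by metis
  have "r2 < 2 ^ e"
    using adm(2) p2 admissible_triples_iff[OF e] by simp
  have "[4 * r = 4 * r2] (mod (4 * 2 ^ e))"
    using same[of 1] unfolding param_map_def cong_add_lcancel_nat by simp
  then have r2: "r2 = r"
    using r \<open>r2 < 2 ^ e\<close> cong_less_modulus_unique_nat[of "4 * r" "4 * r2" "4 * 2 ^ e"] by simp
  have "[4 * (r * (1 + geo s t)) = 4 * (r * (1 + geo s2 t2))] (mod (4 * 2 ^ e))"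
    using same[of 2] unfolding r2 param_map_def cong_add_lcancel_nat
    by (simp add: geo_Suc numeral_2_eq_2)
  then have "[r * (1 + geo s t) = r * (1 + geo s2 t2)] (mod 2 ^ e)"
    by (simp only: cong_mult_modulus_iff zero_less_numeral)
  then have "[2 ^ v * (r' * (1 + geo s t)) = 2 ^ v * (r' * (1 + geo s2 t2))] (mod 2 ^ v * 2 ^ (j + 4))"
    unfolding *(1,2) by (simp only: power_add mult.assoc)
  then have "[r' * (1 + geo s t) = r' * (1 + geo s2 t2)] (mod 2 ^ (j + 4))"
    by (simp only: cong_mult_modulus_iff zero_less_power zero_less_numeral)
  then have tau: "[geo s t = geo s2 t2] (mod 2 ^ (j + 4))"
    using *(3) by (simp only: cong_mult_lcancel_nat coprime_power_right_iff coprime_right_2_iff_odd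
        cong_add_lcancel_nat simp_thms)
  have t2: "t2 < 2 ^ (j + 4)" "ord (2 ^ (j + 4)) t2 = 4" "s2 = triple_s e r t2"
    using adm(2) *(1) v unfolding p2 r2 admissible_triples_iff[OF e] by auto
  have s1: "[s = 1] (mod 4)" "[s2 = 1] (mod 4)"
    using param_conditions_iff[OF *, of s] param_conditions_iff[OF *(1-3) t2(1,2), of s2] s t2(3) by auto
  have geo_mod_4: "[geo x y = y] (mod 4)" if "[x = 1] (mod 4)" for x y :: nat
    using cong_geo[OF that, of y] by (simp add: geo_def)
  have "[geo s t = geo s2 t2] (mod 4)"
    using tau by (rule cong_dvd_modulus_nat) (simp add: power_add)
  then have "[t = t2] (mod 4)"
    using geo_mod_4[OF s1(1), of t] geo_mod_4[OF s1(2), of t2] by (metis cong_sym cong_trans)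
  then have "s2 = s"
    unfolding s t2(3) triple_s_def by (simp add: cong_def)
  then have "[geo (int s) t = geo (int s) t2] (mod 2 ^ (j + 4))"
    using tau by (simp flip: of_nat_geo cong_int_iff)
  then have "[t = t2] (mod 2 ^ (j + 4))"
    using geo_cong_iff[of "int s"] s1(1) by (simp flip: cong_int_iff)
  then have "t = t2"
    using *(4) t2(1) by (simp add: cong_less_modulus_unique_nat)
  then show ?thesis using p p2 r2 \<open>s2 = s\<close> by simp
qed

text \<open>
  This excludes orders \<open>m\<close> dividing \<open>8\<close>, and thereby all \<open>e < 4\<close>.
\<close>

lemma ord_dvd_2_of_modulus_dvd_8:
  fixes m t :: nat
  assumes "m dvd 8" "coprime m t"
  shows "ord m t dvd 2"
proof (cases "m = 1")
  case False
  have "even m"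
  proof (rule ccontr)
    assume "odd m"
    then have "coprime m (2 ^ 3)"
      by (simp only: coprime_power_right_iff coprime_right_2_iff_odd simp_thms)
    then have "coprime m 8" by simp
    with assms(1) have "m dvd 1" using coprime_absorb_left[of m 8] by blast
    with False show False by simp
  qed
  then have "odd t" using assms(2) by (metis coprime_common_divisor_nat odd_one dvd_refl)
  then obtain a where a: "t = 2 * a + 1" by (rule oddE)
  have "even (a * (a + 1))" by simp
  then obtain b where b: "a * (a + 1) = 2 * b" by (rule evenE)
  have "t\<^sup>2 = 8 * b + 1"
    using b unfolding a by (simp add: power2_eq_square algebra_simps)
  then have "[t\<^sup>2 = 1] (mod 8)" by (simp add: cong_def mod_simps)
  then have "[t\<^sup>2 = 1] (mod m)" using assms(1) by (rule cong_dvd_modulus_nat)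
  then show ?thesis by (simp only: ord_divides)
qed simp

lemma admissible_triple_of_morphism:
  assumes \<phi>: "\<phi> \<in> smooth_skew_morphisms_of_type (integer_mod_group (2 ^ (e + 2))) 4"
  shows "e \<ge> 4" "\<exists>p \<in> admissible_triples e. given_by_triple e \<phi> p"
proof -
  obtain M m r s t where n_eq: "4 * M = 2 ^ (e + 2)" and "r < M" and t_less: "t < m"
    and params: "skew_params 4 M m r s t" and "[s ^ m = 1] (mod M)"
    and \<phi>_eq: "\<And>y. \<phi> (int (y mod 2 ^ (e + 2))) = int (param_map 4 r s t y mod 2 ^ (e + 2))"
    by (rule smooth_skew_morphism_params[OF _ _ \<phi>]) auto
  have "M = 2 ^ e" using n_eq by (simp add: power_add)
  then have r_less: "r < 2 ^ e" and params: "skew_params 4 (2 ^ e) m r s t" and s_pow_m: "[s ^ m = 1] (mod 2 ^ e)"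
    using \<open>r < M\<close> params \<open>[s ^ m = 1] (mod M)\<close> by auto
  note dvd_iff = skew_params.dvd_iff[OF params] and ord_t = skew_params.ord_t[OF params]
    and coprime_m_t = skew_params.coprime_m_t[OF params] and m_pos = skew_params.m[OF params]
    and s_eq = skew_params.s_eq[OF params] and s_pow_t = skew_params.s_pow_t[OF params]
  have not_dvd_8: "\<not> m dvd 8"
    using ord_dvd_2_of_modulus_dvd_8[OF _ coprime_m_t] ord_t by auto
  \<comment> \<open>For \<open>e = 0\<close> the kernel is trivial and \<open>s\<close> carries no information.\<close>
  have odd_s: "odd s" if "e > 0"
  proof
    assume "even s"
    then have "even (s ^ m)" using m_pos by simp
    moreover have "[s ^ m = 1] (mod 2)"
      using s_pow_m by (rule cong_dvd_modulus_nat) (use that in simp)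
    ultimately show False by (simp add: cong_def even_iff_mod_2_eq_zero)
  qed
  show e: "e \<ge> 4"
  proof (rule ccontr)
    assume "\<not> e \<ge> 4"
    then have "(2::nat) ^ e dvd 2 ^ 3" by (intro le_imp_power_dvd) simp
    moreover have "8 dvd geo s 8" if "e > 0"
      using geo_8_dvd odd_s that by simp
    ultimately have "2 ^ e dvd r * geo s 8"
      by (cases "e = 0") (auto intro: dvd_mult dvd_trans)
    then show False using dvd_iff not_dvd_8 by blast
  qed
  have "odd s" using odd_s e by simp
  have "r \<noteq> 0"
  proof
    assume "r = 0"
    then have "m dvd 8" using dvd_iff[of 8] by simp
    with not_dvd_8 show False by simp
  qed
  have odd_geo: "odd (geo s i) \<longleftrightarrow> odd i" for i
    using \<open>odd s\<close> by (induction i) (simp_all add: geo_Suc)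
  have "even m"
  proof (rule ccontr)
    assume "odd m"
    then have "coprime (2 ^ e) (geo s m)" using odd_geo by simp
    then have "2 ^ e dvd r" using dvd_iff[of m] by (simp add: coprime_dvd_mult_left_iff)
    then show False using r_less \<open>r \<noteq> 0\<close> by (auto dest: dvd_imp_le)
  qed
  then have "odd t" using coprime_m_t by (metis coprime_common_divisor_nat odd_one dvd_refl)
  \<comment> \<open>\<open>\<tau>\<close> is odd, so \<open>(1 + \<tau>)(1 + \<tau>\<^sup>2)\<close> is a multiple of \<open>4\<close>.\<close>
  have s1: "[s = 1] (mod 4)"
  proof -
    have "odd (geo s t)" using odd_geo \<open>odd t\<close> by simp
    then obtain a where a: "geo s t = 2 * a + 1" by (rule oddE)
    have "geo (geo s t) 4 = 4 * ((a + 1) * (2 * a\<^sup>2 + 2 * a + 1))"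
      unfolding a geo_4 by (simp add: power2_eq_square power3_eq_cube algebra_simps)
    then have "4 dvd r * geo (geo s t) 4" by simp
    then have "[1 + r * geo (geo s t) 4 = 1] (mod 4)"
      unfolding cong_add_lcancel_0_nat cong_0_iff .
    moreover have "[s = 1 + r * geo (geo s t) 4] (mod 4)"
      using s_eq
      by (rule cong_dvd_modulus_nat) (use e le_imp_power_dvd[of 2 e "2::nat"] in simp)
    ultimately show ?thesis by (metis cong_trans)
  qed
  define v where "v = multiplicity 2 r"
  obtain r' where r': "r = 2 ^ v * r'" "odd r'"
    using \<open>r \<noteq> 0\<close> multiplicity_decompose'[of r 2] unfolding v_def by auto
  have "v < e"
  proof -
    have "2 ^ v \<le> r" using r' \<open>r \<noteq> 0\<close> by auto
    also have "r < 2 ^ e" using r_less by simp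
    finally show ?thesis by simp
  qed
  have m: "m = 2 ^ (e - v)"
  proof (rule dvd_antisym)
    have *: "m dvd i \<longleftrightarrow> 2 ^ (e - v) dvd i" for i
      using dvd_iff[of i] two_pow_dvd_mult_geo_iff[OF r' s1, of "e - v" i] \<open>v < e\<close> by simp
    show "m dvd 2 ^ (e - v)" "2 ^ (e - v) dvd m"
      using *[of "2 ^ (e - v)"] *[of m] by simp_all
  qed
  have "e - v \<ge> 4"
  proof (rule ccontr)
    assume "\<not> e - v \<ge> 4"
    then have "m dvd 2 ^ 3" unfolding m by (intro le_imp_power_dvd) simp
    with not_dvd_8 show False by simp
  qed
  then have "e = v + (e - v - 4) + 4" "e - v = (e - v - 4) + 4" by linarith+
  then obtain j where j: "e = v + j + 4" "e - v = j + 4" by blast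
  have t: "t < 2 ^ (j + 4)" "ord (2 ^ (j + 4)) t = 4"
    using t_less ord_t unfolding m j(2) by auto
  have s: "[s = triple_s e r t] (mod 2 ^ e)"
    using param_conditions_iff[OF j(1) r' t, of s] s1 s_pow_t s_eq by simp
  have "(r, triple_s e r t, t) \<in> admissible_triples e"
    unfolding admissible_triples_iff[OF e]
  proof (intro conjI)
    show "\<not> 2 ^ (e - 3) dvd r"
      using \<open>r \<noteq> 0\<close> j(1) by (subst power_dvd_iff_le_multiplicity) (auto simp flip: v_def)
    show "r < 2 ^ e" using r_less by simp
  qed (use t j(2) v_def in simp_all)
  moreover have "given_by_triple e \<phi> (r, triple_s e r t, t)"
    unfolding given_by_triple_iff
  proof
    fix x
    have "[param_map 4 r s t x = param_map 4 r (triple_s e r t) t x] (mod (4 * 2 ^ e))"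
      using s by (rule param_map_cong)
    then have "param_map 4 r s t x mod 2 ^ (e + 2) = param_map 4 r (triple_s e r t) t x mod 2 ^ (e + 2)"
      by (simp add: cong_def power_add mult.commute)
    then show "\<phi> (int (x mod 2 ^ (e + 2))) = int (param_map 4 r (triple_s e r t) t x mod 2 ^ (e + 2))"
      using \<phi>_eq[of x] by (simp only:)
  qed
  ultimately show "\<exists>p \<in> admissible_triples e. given_by_triple e \<phi> p" by blast
qed

lemma card_eq_of_ex1_both:
  assumes left: "\<forall>x\<in>A. \<exists>!y. y \<in> B \<and> Q x y" and right: "\<forall>y\<in>B. \<exists>!x. x \<in> A \<and> Q x y"
  shows "card A = card B"
proof -
  define f where "f x = (THE y. y \<in> B \<and> Q x y)" for x
  have f: "f x \<in> B \<and> Q x (f x)" if "x \<in> A" for x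
    unfolding f_def by (rule theI') (use left that in blast)
  have "bij_betw f A B"
  proof (rule bij_betwI')
    show "f x = f y \<longleftrightarrow> x = y" if "x \<in> A" "y \<in> A" for x y
      using f[OF that(1)] f[OF that(2)] right that by metis
    show "\<exists>x\<in>A. y = f x" if "y \<in> B" for y
      using that f left right by metis
  qed (use f in blast)
  then show ?thesis by (rule bij_betw_same_card)
qed

theorem theorem1p2:
  fixes e :: nat
  defines "\<S> \<equiv> smooth_skew_morphisms_of_type (integer_mod_group (2 ^ (e + 2))) 4"
  shows "(\<S> \<noteq> {} \<longleftrightarrow> e \<ge> 4) \<and>
    (e \<ge> 4 \<longrightarrow>
       int (card \<S>) = 2 ^ (e + 2) - 32 \<and>
       (\<forall>\<phi>\<in>\<S>. \<exists>!p. p \<in> admissible_triples e \<and> given_by_triple e \<phi> p) \<and>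
       (\<forall>p\<in>admissible_triples e. \<exists>!\<phi>. \<phi> \<in> \<S> \<and> given_by_triple e \<phi> p))"
proof -
  have main: "card \<S> = 2 ^ (e + 2) - 32 \<and>
      (\<forall>\<phi>\<in>\<S>. \<exists>!p. p \<in> admissible_triples e \<and> given_by_triple e \<phi> p) \<and>
      (\<forall>p\<in>admissible_triples e. \<exists>!\<phi>. \<phi> \<in> \<S> \<and> given_by_triple e \<phi> p)" if e: "e \<ge> 4"
  proof -
    have 1: "\<forall>\<phi>\<in>\<S>. \<exists>!p. p \<in> admissible_triples e \<and> given_by_triple e \<phi> p"
    proof
      fix \<phi> assume "\<phi> \<in> \<S>"
      then obtain p where "p \<in> admissible_triples e" "given_by_triple e \<phi> p"
        using admissible_triple_of_morphism(2) unfolding \<S>_def by blast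
      then show "\<exists>!p. p \<in> admissible_triples e \<and> given_by_triple e \<phi> p"
        using admissible_triple_unique[OF e] by blast
    qed
    have 2: "\<forall>p\<in>admissible_triples e. \<exists>!\<phi>. \<phi> \<in> \<S> \<and> given_by_triple e \<phi> p"
      using ex1_morphism_of_admissible_triple[OF e] unfolding \<S>_def by blast
    show ?thesis
      using 1 2 card_eq_of_ex1_both[OF 1 2] card_admissible_triples[OF e] by simp
  qed
  have "(2::nat) ^ 6 \<le> 2 ^ (e + 2)" if "e \<ge> 4"
    using that by (intro power_increasing) auto
  then have card: "int (card \<S>) = 2 ^ (e + 2) - 32" "card \<S> \<noteq> 0" if "e \<ge> 4"
    using main that by (simp_all add: of_nat_diff)
  have "\<S> \<noteq> {} \<longleftrightarrow> e \<ge> 4"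
    using admissible_triple_of_morphism(1)[of _ e] card(2) unfolding \<S>_def by auto
  then show ?thesis using main card(1) by blast
qed

end
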